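(* Let $\varphi:[0,\infty)\to[0,\infty)$ be a non-increasing function such that, for some $\mu>0$ and $\nu>0$, the function $t\mapsto e^{\nu t}\varphi(t)$ is non-decreasing on $[0,\infty)$, and the integral $\int_0^\infty e^{zt}\,d\varphi(t)$ converges for all $z\in\mathbb{C}$ with $0<\operatorname{Re} z<\mu$. Suppose also that there exist $j\ge1$, $D>0$ and a function $h:\mathbb{R}\to\mathbb{C}$ such that the function $$H(z):=\int_0^\infty e^{zt}\varphi(t)\,dt-\frac{D}{(\mu-z)^j},\qquad 0<\operatorname{Re} z<\mu$$ (where the integral is assumed to converge for these $z$), satisfies $$H(z)\to h(\operatorname{Im} z)\qquad\text{as }\operatorname{Re} z\to\mu-,$$ uniformly in $\operatorname{Im} z$ on compact subsets of $\mathbb{R}$; that is, for every compact $K\subset\mathbb{R}$, $\sup_{\tau\in K}|H(x+i\tau)-h(\tau)|\to0$ as $x\to\mu-$. Then $$\varphi(t)\sim\frac{D}{\Gamma(j)}\,t^{j-1}e^{-\mu t},\qquad t\to\infty.$$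
   Context: The integral $\int_0^\infty e^{zt}\,d\varphi(t)$ is a (possibly improper) Riemann–Stieltjes integral with respect to the monotone function $\varphi$, and integrals over $[0,\infty)$ are understood as limits of integrals over $[0,R]$ as $R\to\infty$. For $\operatorname{Re} z<\mu$, the power $(\mu-z)^j$ is taken with the principal branch. $\Gamma$ is Euler's Gamma function. $f(t)\sim g(t)$ as $t\to\infty$ means $f(t)/g(t)\to1$. *)

theory Defs
  imports "HOL-Analysis.Analysis" "HOL-Library.Landau_Symbols"
begin

text \<open>
  The Riemann--Stieltjes integral of \<open>f\<close> with respect to \<open>g\<close> over \<open>[a, b]\<close> (for \<open>a \<le> b\<close>), as the
  limit of the tagged sums \<open>\<Sum>i. f \<xi>\<^sub>i * (g t\<^sub>i - g t\<^sub>i\<^sub>-\<^sub>1)\<close> when the mesh tends to \<open>0\<close>.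
  The \<open>\<delta>\<close> is a single positive number: a variable gauge would give the weaker
  Henstock--Stieltjes notion.
\<close>

definition has_rs_integral ::
  "(real \<Rightarrow> 'a::real_normed_vector) \<Rightarrow> (real \<Rightarrow> real) \<Rightarrow> 'a \<Rightarrow> real \<Rightarrow> real \<Rightarrow> bool"
  where "has_rs_integral f g I a b \<longleftrightarrow>
    (\<forall>\<epsilon>>0. \<exists>\<delta>>0. \<forall>p. p tagged_division_of {a..b} \<and> (\<forall>(x, k)\<in>p. Sup k - Inf k < \<delta>) \<longrightarrow>
       norm ((\<Sum>(x, k)\<in>p. (g (Sup k) - g (Inf k)) *\<^sub>R f x) - I) < \<epsilon>)"

definition improper_rs_integral_converges ::
  "(real \<Rightarrow> 'a::real_normed_vector) \<Rightarrow> (real \<Rightarrow> real) \<Rightarrow> bool"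
  where "improper_rs_integral_converges f g \<longleftrightarrow>
    (\<exists>F I. (\<forall>R\<ge>0. has_rs_integral f g (F R) 0 R) \<and> (F \<longlongrightarrow> I) at_top)"

definition improper_integral_converges :: "(real \<Rightarrow> 'a::real_normed_vector) \<Rightarrow> bool"
  where "improper_integral_converges f \<longleftrightarrow>
    (\<forall>R\<ge>0. f integrable_on {0..R}) \<and> (\<exists>I. ((\<lambda>R. integral {0..R} f) \<longlongrightarrow> I) at_top)"

definition improper_integral :: "(real \<Rightarrow> 'a::real_normed_vector) \<Rightarrow> 'a"
  where "improper_integral f = Lim at_top (\<lambda>R. integral {0..R} f)"

end

theory Submission
  imports Defs "HOL-Probability.Sinc_Integral"
begin

text \<open>
  Write \<open>p t = e\<^bsup>\<mu>t\<^esup> \<phi> t\<close> and \<open>E t = (D / \<Gamma>(j)) t\<^bsup>j-1\<^esup>\<close>. Then \<open>H (\<mu> - x + i\<tau>)\<close> is the Fourier--Laplace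
  transform of \<open>p - E\<close> at \<open>x - i\<tau>\<close>. Averaging \<open>(p - E) e\<^bsup>-xt\<^esup>\<close> against a Fejer kernel centred at \<open>y\<close>
  turns into an integral of this transform over a bounded \<open>\<tau>\<close>-interval. Coupling \<open>x = 1 / y\<close>, the
  uniform convergence to \<open>h\<close> together with the Riemann--Lebesgue lemma for \<open>h\<close> makes it tend to \<open>0\<close> as
  \<open>y \<rightarrow> \<infinity>\<close>. Since the damping factor \<open>e\<^bsup>-t/y\<^esup>\<close> is kept, \<open>E\<close> can be averaged against the Fejer
  kernel for every \<open>j\<close>, although \<open>t\<^bsup>j-1\<^esup>\<close> times the kernel need not be integrable. The two
  monotonicity hypotheses on \<open>\<phi>\<close> bound \<open>p s / p t\<close> by \<open>e\<^bsup>M|s-t|\<^esup>\<close>, so the averages determine \<open>p y\<close>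
  asymptotically when the kernel is narrowed.
\<close>

subsection \<open>The Laplace transform of a power\<close>

text \<open>Euler's integral for \<open>Gamma a\<close> with the variable rescaled by
  \<open>x\<close>. It supplies the moments for the termwise integration at complex
  \<open>s\<close>, and the integrability of the damped comparison function
  \<open>E\<close>.\<close>

lemma has_bochner_integral_laplace_powr_real:
  fixes a x :: real
  assumes "a > 0" "x > 0"
  shows "has_bochner_integral lborel (\<lambda>t. indicator {0..} t * t powr (a - 1) * exp (- x * t))
           (Gamma a / x powr a)"
proof -
  let ?f = "\<lambda>t::real. indicator {0..} t * t powr (a - 1) / exp t"
  have "integral\<^sup>N lborel (\<lambda>t. ennreal (?f t)) = ennreal (Gamma a)"
    using Gamma_conv_nn_integral_real[OF \<open>a > 0\<close>] by simp
  moreover have "0 \<le> Gamma a"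
    using \<open>a > 0\<close> by (intro Gamma_real_nonneg) auto
  ultimately have "has_bochner_integral lborel ?f (Gamma a)"
    by (intro has_bochner_integral_nn_integral) auto
  hence "has_bochner_integral lborel (\<lambda>t. ?f (0 + x * t)) (Gamma a /\<^sub>R \<bar>x\<bar>)"
    by (subst (asm) lborel_has_bochner_integral_real_affine_iff[of x _ _ 0]) (use \<open>x > 0\<close> in auto)
  hence "has_bochner_integral lborel (\<lambda>t. ?f (0 + x * t) / x powr (a - 1))
           (Gamma a /\<^sub>R \<bar>x\<bar> / x powr (a - 1))"
    by (rule has_bochner_integral_divide_zero)
  also have "(\<lambda>t. ?f (0 + x * t) / x powr (a - 1)) =
      (\<lambda>t. indicator {0..} t * t powr (a - 1) * exp (- x * t))"
    using \<open>x > 0\<close>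
    by (auto simp: fun_eq_iff indicator_def powr_mult exp_minus field_simps zero_le_mult_iff)
  also have "Gamma a /\<^sub>R \<bar>x\<bar> / x powr (a - 1) = Gamma a / x powr a"
    using \<open>x > 0\<close> by (simp add: powr_diff field_simps)
  finally show ?thesis .
qed

text \<open>This identifies the subtracted term D / (\<mu> - z)^j as the transform of a multiple of
  t^(j-1). The principal branch is reached from a real point by a power series, so no contour has to
  be rotated.\<close>

lemma has_bochner_integral_laplace_powr_complex:
  fixes a :: real and s :: complex
  assumes "a > 0" "Re s > 0"
  shows "has_bochner_integral lborel
           (\<lambda>t. of_real (indicator {0..} t * t powr (a - 1)) * exp (- s * of_real t))
           (of_real (Gamma a) / s powr of_real a)"
proof -
  \<comment> \<open>A real point with \<open>|x - s| < x\<close>: expanding \<open>e\<^bsup>(x-s)t\<^esup>\<close> under \<open>e\<^bsup>-xt\<^esup>\<close> and integrating termwise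
    gives the binomial series of \<open>(s / x)\<^bsup>-a\<^esup>\<close>.\<close>
  define x where "x = (cmod s)\<^sup>2 / (2 * Re s) + 1"
  have "x > 0" using assms by (auto simp: x_def intro!: add_nonneg_pos)
  \<comment> \<open>The summand 1 in \<open>x\<close> makes \<open>2 * Re s * x\<close> exceed the
    square of \<open>cmod s\<close>, which is exactly what puts \<open>s\<close> inside the disc of
    radius \<open>x\<close> about \<open>x\<close>.\<close>
  have "(cmod (of_real x - s))\<^sup>2 = x\<^sup>2 - 2 * Re s * x + (cmod s)\<^sup>2"
    unfolding cmod_power2 by (simp add: power2_eq_square algebra_simps)
  also have "2 * Re s * x = (cmod s)\<^sup>2 + 2 * Re s"
    using assms by (simp add: x_def field_simps)
  also have "x\<^sup>2 - ((cmod s)\<^sup>2 + 2 * Re s) + (cmod s)\<^sup>2 < x\<^sup>2"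
    using assms by simp
  finally have less: "cmod (of_real x - s) < x"
    using \<open>x > 0\<close> power_less_imp_less_base by fastforce
  define r where "r = cmod (of_real x - s)"
  define g where "g = (\<lambda>(n::nat) t::real. indicator {0..} t * t powr (a - 1) * exp (- x * t) * t ^ n / fact n)"
  define I where "I = (\<lambda>n::nat. Gamma a / x powr a * (pochhammer a n / fact n) / x ^ n)"
  have g: "has_bochner_integral lborel (g n) (I n)" for n
  proof -
    have "has_bochner_integral lborel (\<lambda>t. indicator {0..} t * t powr (a + n - 1) * exp (- x * t) / fact n)
           (Gamma (a + n) / x powr (a + n) / fact n)"
      using has_bochner_integral_laplace_powr_real[of "a + n" x] \<open>x > 0\<close> assms
      by (intro has_bochner_integral_divide_zero) auto
    also have "(\<lambda>t. indicator {0..} t * t powr (a + n - 1) * exp (- x * t) / fact n) = g n"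
      by (auto simp: fun_eq_iff g_def indicator_def powr_add powr_diff field_simps)
         (metis order_le_less powr_realpow)
    also have "Gamma (a + n) / x powr (a + n) / fact n = I n"
    proof -
      have "a \<notin> \<int>\<^sub>\<le>\<^sub>0" using assms by (auto elim!: nonpos_Ints_cases)
      hence "Gamma (a + n) = pochhammer a n * Gamma a"
        using assms pochhammer_Gamma[of a n] by (simp add: Gamma_eq_zero_iff)
      thus ?thesis using \<open>x > 0\<close> by (simp add: I_def powr_add powr_realpow mult_ac)
    qed
    finally show ?thesis .
  qed
  have g_nonneg: "g n t \<ge> 0" for n t by (auto simp: g_def indicator_def)
  have I_nonneg: "I n \<ge> 0" for n
    using g_nonneg has_bochner_integral_integral_eq[OF g, of n] 
    by (metis integral_nonneg_AE AE_I2)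
  define f where "f = (\<lambda>(n::nat) t::real. of_real (g n t) * (of_real x - s) ^ n)"
  have f: "has_bochner_integral lborel (f n) (of_real (I n) * (of_real x - s) ^ n)" for n
    unfolding f_def by (intro has_bochner_integral_mult_left has_bochner_integral_of_real g)
  have norm_f: "norm (f n t) = g n t * r ^ n" for n t
    using g_nonneg[of n t] by (simp add: f_def norm_mult norm_power r_def)
  have f_sums: "(\<lambda>n. f n t) sums (of_real (indicator {0..} t * t powr (a - 1)) * exp (- s * of_real t))" for t
  proof -
    have "(\<lambda>n. of_real (indicator {0..} t * t powr (a - 1) * exp (- x * t)) *
             (((of_real x - s) * of_real t) ^ n /\<^sub>R fact n)) sums
           (of_real (indicator {0..} t * t powr (a - 1) * exp (- x * t)) * exp ((of_real x - s) * of_real t))"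
      by (intro sums_mult exp_converges)
    also have "of_real (indicator {0..} t * t powr (a - 1) * exp (- x * t)) * exp ((of_real x - s) * of_real t)
       = of_real (indicator {0..} t * t powr (a - 1)) * exp (- s * of_real t)"
      by (simp add: exp_of_real [symmetric] mult.assoc exp_add [symmetric] algebra_simps)
    also have "(\<lambda>n. of_real (indicator {0..} t * t powr (a - 1) * exp (- x * t)) *
             (((of_real x - s) * of_real t) ^ n /\<^sub>R fact n)) = (\<lambda>n. f n t)"
      by (auto simp: fun_eq_iff f_def g_def power_mult_distrib scaleR_conv_of_real divide_inverse mult_ac)
    finally show ?thesis .
  qed
  have norm_f_sums: "(\<lambda>n. norm (f n t)) sums (indicator {0..} t * t powr (a - 1) * exp (- x * t) * exp (r * t))" for t
  proof -
    have "(\<lambda>n. (indicator {0..} t * t powr (a - 1) * exp (- x * t)) * ((r * t) ^ n /\<^sub>R fact n)) sums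
           (indicator {0..} t * t powr (a - 1) * exp (- x * t) * exp (r * t))"
      by (intro sums_mult exp_converges)
    also have "(\<lambda>n. (indicator {0..} t * t powr (a - 1) * exp (- x * t)) * ((r * t) ^ n /\<^sub>R fact n))
       = (\<lambda>n. norm (f n t))"
      by (auto simp: fun_eq_iff norm_f g_def power_mult_distrib field_simps)
    finally show ?thesis .
  qed
  have gbin: "(- b gchoose n) * w ^ n = pochhammer b n / fact n * (- w) ^ n" 
    for b w :: "'b :: field_char_0" and n
    by (simp add: gbinomial_pochhammer power_minus[of w])
  have r: "r / x < 1" "r \<ge> 0" using less \<open>x > 0\<close> by (auto simp: r_def)
  \<comment> \<open>The norms integrate to the binomial series with the same exponent at the real
    point \<open>- (r / x)\<close>. Its convergence for \<open>r < x\<close> permits exchanging sum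
    and integral.\<close>
  have "(\<lambda>n. (- a gchoose n) * (- (r / x)) ^ n) sums (1 + - (r / x)) powr (- a)"
    using r \<open>x > 0\<close> by (intro gen_binomial_real) auto
  hence "summable (\<lambda>n. Gamma a / x powr a * (pochhammer a n / fact n * (r / x) ^ n))"
    unfolding gbin by (intro summable_mult) (auto simp: sums_iff)
  also have "(\<lambda>n. Gamma a / x powr a * (pochhammer a n / fact n * (r / x) ^ n)) = (\<lambda>n. \<integral>t. norm (f n t) \<partial>lborel)"
    using g by (auto simp: fun_eq_iff norm_f I_def power_divide has_bochner_integral_iff)
  finally have summable_norms: "summable (\<lambda>n. \<integral>t. norm (f n t) \<partial>lborel)" .
  have eq: "(\<lambda>t. \<Sum>n. f n t) = (\<lambda>t. of_real (indicator {0..} t * t powr (a - 1)) * exp (- s * of_real t))"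
    using f_sums by (auto simp: fun_eq_iff sums_iff)
  have int_f: "integrable lborel (f n)" for n using f[of n] by (auto simp: has_bochner_integral_iff)
  have AE: "AE t in lborel. summable (\<lambda>n. norm (f n t))"
    using norm_f_sums by (auto simp: sums_iff)
  note sums = integrable_suminf[OF int_f AE summable_norms] sums_integral[OF int_f AE summable_norms]
  have "norm ((s - of_real x) / of_real x) < 1"
    using r \<open>x > 0\<close> by (simp add: norm_divide r_def norm_minus_commute)
  from gen_binomial_complex[OF this, of "- of_real a"]
  have "(\<lambda>n. of_real (Gamma a / x powr a) * (pochhammer (of_real a) n / fact n * (- ((s - of_real x) / of_real x)) ^ n)) sums
     (of_real (Gamma a / x powr a) * (1 + (s - of_real x) / of_real x) powr (- of_real a))"
    unfolding gbin by (rule sums_mult)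
  also have "(\<lambda>n. of_real (Gamma a / x powr a) * (pochhammer (of_real a) n / fact n * (- ((s - of_real x) / of_real x)) ^ n))
    = (\<lambda>n. integral\<^sup>L lborel (f n))"
  proof
    fix n
    have "- ((s - of_real x) / of_real x) = (of_real x - s) / of_real x"
      by (simp add: minus_divide_left)
    thus "of_real (Gamma a / x powr a) * (pochhammer (of_real a) n / fact n * (- ((s - of_real x) / of_real x)) ^ n)
       = integral\<^sup>L lborel (f n)"
      using f[of n] by (simp add: I_def has_bochner_integral_iff pochhammer_of_real power_divide mult_ac)
  qed
  also have "1 + (s - of_real x) / of_real x = of_real (1 / x) * s"
    using \<open>x > 0\<close> by (simp add: field_simps)
  \<comment> \<open>A positive real factor leaves the argument unchanged, so it splits off the
    principal power.\<close>
  also have "\<dots> powr (- of_real a) = of_real (1 / x) powr (- of_real a) * s powr (- of_real a)"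
    using \<open>x > 0\<close> by (subst powr_times_real_left) auto
  also have "of_real (1 / x) powr (- of_real a) = complex_of_real (x powr a)"
    using \<open>x > 0\<close> powr_of_real[of "1/x" "-a"] by (simp add: powr_divide powr_minus divide_simps)
  also have "of_real (Gamma a / x powr a) * (complex_of_real (x powr a) * s powr (- of_real a)) = of_real (Gamma a) / s powr of_real a"
    using \<open>x > 0\<close> by (simp add: powr_minus field_simps)
  finally have "(\<integral>t. (\<Sum>n. f n t) \<partial>lborel) = of_real (Gamma a) / s powr of_real a"
    using sums(2) by (rule sums_unique2[THEN sym])
  with sums(1) show ?thesis unfolding eq has_bochner_integral_iff by blast
qed

subsection \<open>The Fejer kernel\<close>

text \<open>The Fourier-side weight of the Fejer kernel. Its bounded support confines the later
  integrals to a compact range of \<open>\<tau>\<close>.\<close>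

definition tent :: "real \<Rightarrow> real \<Rightarrow> real"
  where "tent L \<tau> = max 0 (1 - \<bar>\<tau>\<bar> / L)"

text \<open>Away from 0 this is L (sin(Lt/2) / (Lt/2))^2, and the value \<open>L\<close> at 0 is the
  continuous extension. There is no factor 1/(2 pi), so the total mass is not 1.\<close>

definition fejer :: "real \<Rightarrow> real \<Rightarrow> real"
  where "fejer L t = (if t = 0 then L else 2 * (1 - cos (L * t)) / (L * t\<^sup>2))"

lemma continuous_on_tent [continuous_intros]: "continuous_on A (tent L)"
  unfolding tent_def[abs_def] divide_inverse by (intro continuous_intros)

lemma borel_measurable_tent [measurable]: "tent L \<in> borel_measurable borel"
  by (intro borel_measurable_continuous_onI continuous_intros)

lemma tent_nonneg: "tent L \<tau> \<ge> 0"
  by (simp add: tent_def)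

lemma tent_le_1: "L > 0 \<Longrightarrow> tent L \<tau> \<le> 1"
  by (simp add: tent_def)

lemma tent_eq_0: "L > 0 \<Longrightarrow> L \<le> \<bar>\<tau>\<bar> \<Longrightarrow> tent L \<tau> = 0"
  by (simp add: tent_def)

lemma tent_le_indicator: "L > 0 \<Longrightarrow> tent L \<tau> \<le> indicator {-L..L} \<tau>"
  by (auto simp: tent_def indicator_def abs_le_iff field_simps)

lemma borel_measurable_cis [measurable]: "cis \<in> borel_measurable borel"
  unfolding cis_conv_exp[abs_def] by (intro borel_measurable_continuous_onI continuous_intros)

lemma integrable_tent_mult:
  fixes f :: "real \<Rightarrow> complex"
  assumes "L > 0" and [measurable]: "f \<in> borel_measurable borel" and "\<And>\<tau>. \<bar>\<tau>\<bar> \<le> L \<Longrightarrow> norm (f \<tau>) \<le> B"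
  shows "integrable lborel (\<lambda>\<tau>. of_real (tent L \<tau>) * f \<tau>)"
proof (rule Bochner_Integration.integrable_bound)
  show "integrable lborel (\<lambda>\<tau>. indicator {-L..L} \<tau> * B)"
    by (intro integrable_mult_left integrable_real_indicator) (auto simp: emeasure_lborel_Icc_eq)
  have "norm (of_real (tent L \<tau>) * f \<tau>) \<le> norm (indicator {-L..L} \<tau> * B)" for \<tau>
  proof (cases "\<bar>\<tau>\<bar> \<le> L")
    case True
    hence "indicator {-L..L} \<tau> = (1 :: real)" by (auto simp: indicator_def)
    moreover have "tent L \<tau> * norm (f \<tau>) \<le> 1 * B"
      using True assms(3)[of \<tau>] tent_nonneg[of L \<tau>] tent_le_1[OF \<open>L > 0\<close>, of \<tau>]
      by (intro mult_mono) auto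
    ultimately show ?thesis
      using tent_nonneg[of L \<tau>] by (auto simp: norm_mult)
  qed (use tent_eq_0[of L \<tau>] \<open>L > 0\<close> in auto)
  thus "AE \<tau> in lborel. norm (of_real (tent L \<tau>) * f \<tau>) \<le> norm (indicator {-L..L} \<tau> * B)"
    by simp
qed auto

lemma borel_measurable_fejer [measurable]: "fejer L \<in> borel_measurable borel"
  unfolding fejer_def[abs_def] by measurable

lemma fejer_nonneg: "L > 0 \<Longrightarrow> fejer L t \<ge> 0"
  by (auto simp: fejer_def)

lemma fejer_scale: "L > 0 \<Longrightarrow> fejer L t = L * fejer 1 (L * t)"
  by (auto simp: fejer_def field_simps power2_eq_square)

text \<open>The constant is 1 + 4: the quantity \<open>2 * (1 - cos t)\<close> is at most t^2 and at
  most 4, and these two bounds serve the summands 1 and t^2 of the factor 1 + t^2.\<close>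

lemma fejer_1_bound: "fejer 1 t \<le> 5 * inverse (1 + t\<^sup>2)"
proof (cases "t = 0")
  case False
  have "1 - cos t = 2 * (sin (t / 2))\<^sup>2"
    using cos_double_sin[of "t / 2"] by simp
  also have "(sin (t / 2))\<^sup>2 \<le> (t / 2)\<^sup>2"
    using abs_sin_x_le_abs_x[of "t / 2"] by (rule abs_le_square_iff[THEN iffD1])
  finally have "1 - cos t \<le> t\<^sup>2 / 2"
    by (simp add: power_divide)
  hence "2 * (1 - cos t) * (1 + t\<^sup>2) \<le> 5 * t\<^sup>2"
    using mult_right_mono[of "1 - cos t" 2 "t\<^sup>2"] cos_ge_minus_one[of t] by (simp add: algebra_simps)
  moreover have "1 + t\<^sup>2 > 0" by (simp add: add_pos_nonneg)
  ultimately show ?thesis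
    using False by (simp add: fejer_def divide_simps)
qed (simp add: fejer_def)

lemma integrable_fejer_1: "integrable lborel (fejer 1)"
proof (rule Bochner_Integration.integrable_bound)
  show "integrable lborel (\<lambda>t::real. 5 * inverse (1 + t\<^sup>2))"
    using integrable_inverse_1_plus_square by (simp add: set_integrable_def)
  show "AE t in lborel. norm (fejer 1 t) \<le> norm (5 * inverse (1 + t\<^sup>2) :: real)"
    using fejer_1_bound fejer_nonneg[of 1] by (auto intro!: AE_I2 simp: abs_of_nonneg)
qed auto

text \<open>The total mass cancels in \<open>tauberian_kernel\<close>, so positivity is the form in
  which it enters there. A vanishing integral would force cos t = 1 almost everywhere on (0,
  1).\<close>

lemma integral_fejer_1_pos: "integral\<^sup>L lborel (fejer 1) > 0"
proof (rule ccontr)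
  assume "\<not> ?thesis"
  hence "integral\<^sup>L lborel (fejer 1) = 0"
    using fejer_nonneg[of 1] by (metis AE_I2 integral_nonneg_AE less_eq_real_def zero_less_one)
  hence "AE t in lborel. fejer 1 t = 0"
    using integral_nonneg_eq_0_iff_AE[OF integrable_fejer_1] fejer_nonneg[of 1] by simp
  hence "AE t in lborel. (t::real) \<notin> {0<..<1}"
  proof eventually_elim
    case (elim t)
    show ?case
    proof
      assume "t \<in> {0<..<1}"
      hence "cos t < cos 0" using pi_gt3 by (intro cos_monotone_0_pi) auto
      with elim \<open>t \<in> _\<close> show False by (simp add: fejer_def)
    qed
  qed
  hence "{0<..<1::real} \<in> null_sets lborel"
    by (subst AE_iff_null_sets) auto
  thus False by (simp add: null_sets_def)
qed

lemma integral_tent_cis: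
  assumes "L > 0"
  shows "(\<integral>\<tau>. of_real (tent L \<tau>) * cis (\<tau> * t) \<partial>lborel) = of_real (fejer L t)"
proof -
  define f where "f = (\<lambda>\<tau>. of_real (tent L \<tau>) * cis (\<tau> * t))"
  \<comment> \<open>Applied with \<open>w = \<i> * of_real t\<close> on the right half and, after
    reflection, with the opposite sign on the left half. The two terms in \<open>1 / w\<close>
    cancel when the halves are added, and the exponentials combine to a cosine.\<close>
  have half: "((\<lambda>\<tau>. of_real (1 - \<tau> / L) * exp (w * of_real \<tau>)) has_integral
      (if w = 0 then of_real L / 2 else (exp (w * of_real L) - 1) / (of_real L * w\<^sup>2) - 1 / w)) {0..L}" for w :: complex
  proof (cases "w = 0")
    case True
    define F where "F = (\<lambda>\<tau>::complex. \<tau> - \<tau>\<^sup>2 / (2 * of_real L))"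
    have "(F has_field_derivative (1 - \<tau> / of_real L)) (at \<tau>)" for \<tau>
      unfolding F_def using assms by (auto intro!: derivative_eq_intros simp: field_simps)
    hence "((\<lambda>\<tau>. 1 - of_real \<tau> / of_real L) has_integral F (of_real L) - F (of_real 0)) {0..L}"
      using assms
      by (intro fundamental_theorem_of_calculus[where f = "\<lambda>x. F (of_real x)"]
                has_vector_derivative_real_field) auto
    also have "F (of_real L) - F (of_real 0) = of_real L / 2"
      using assms by (simp add: F_def power2_eq_square field_simps)
    finally show ?thesis using True by simp
  next
    case False
    define F where "F = (\<lambda>\<tau>::complex. (1 - \<tau> / of_real L) * exp (w * \<tau>) / w + exp (w * \<tau>) / (of_real L * w\<^sup>2))"
    have "(F has_field_derivative (1 - \<tau> / of_real L) * exp (w * \<tau>)) (at \<tau>)" for \<tau>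
      unfolding F_def using False assms
      by (auto intro!: derivative_eq_intros simp: field_simps power2_eq_square)
    hence "((\<lambda>\<tau>. (1 - of_real \<tau> / of_real L) * exp (w * of_real \<tau>)) has_integral F (of_real L) - F (of_real 0)) {0..L}"
      using assms
      by (intro fundamental_theorem_of_calculus[where f = "\<lambda>x. F (of_real x)"]
                has_vector_derivative_real_field) auto
    also have "F (of_real L) - F (of_real 0) = (exp (w * of_real L) - 1) / (of_real L * w\<^sup>2) - 1 / w"
      using assms False by (simp add: F_def diff_divide_distrib)
    finally show ?thesis using False by simp
  qed
  have cis: "cis (\<tau> * t) = exp (\<i> * of_real t * of_real \<tau>)" for \<tau>
    by (simp add: cis_conv_exp mult_ac)
  have right: "(f has_integral (if \<i> * of_real t = 0 then of_real L / 2 else (exp (\<i> * of_real t * of_real L) - 1) / (of_real L * (\<i> * of_real t)\<^sup>2) - 1 / (\<i> * of_real t))) {0..L}"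
    by (rule has_integral_eq[OF _ half]) (use assms in \<open>auto simp: f_def tent_def cis field_simps\<close>)
  have "((\<lambda>\<tau>. f (- \<tau>)) has_integral (if - (\<i> * of_real t) = 0 then of_real L / 2 else (exp (- (\<i> * of_real t) * of_real L) - 1) / (of_real L * (- (\<i> * of_real t))\<^sup>2) - 1 / (- (\<i> * of_real t)))) {0..L}"
    by (rule has_integral_eq[OF _ half]) (use assms in \<open>auto simp: f_def tent_def cis field_simps\<close>)
  hence left: "(f has_integral (if - (\<i> * of_real t) = 0 then of_real L / 2 else (exp (- (\<i> * of_real t) * of_real L) - 1) / (of_real L * (- (\<i> * of_real t))\<^sup>2) - 1 / (- (\<i> * of_real t)))) {-L..-0}"
    by (subst (asm) has_integral_reflect_real[symmetric]) simp
  have "integrable lborel f"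
    unfolding f_def by (rule integrable_tent_mult[of _ _ 1]) (use assms in auto)
  hence "(f has_integral integral\<^sup>L lborel f) UNIV"
    by (rule has_integral_integral_lborel)
  moreover have "(f has_integral of_real (fejer L t)) {-L..L}"
  proof -
    have e: "exp (\<i> * of_real t * of_real L) + exp (- (\<i> * of_real t) * of_real L) = of_real (2 * cos (L * t))"
      by (simp add: cos_of_real [symmetric] cos_exp_eq mult_ac del: cos_of_real)
    have "(exp (\<i> * of_real t * of_real L) - 1) / (of_real L * (\<i> * of_real t)\<^sup>2) - 1 / (\<i> * of_real t) 
       + ((exp (- (\<i> * of_real t) * of_real L) - 1) / (of_real L * (- (\<i> * of_real t))\<^sup>2) - 1 / (- (\<i> * of_real t)))
      = (exp (\<i> * of_real t * of_real L) + exp (- (\<i> * of_real t) * of_real L) - 2) / (of_real L * (\<i> * of_real t)\<^sup>2)" if "t \<noteq> 0"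
      using that assms by (simp add: field_simps)
    also have "\<dots> = of_real (fejer L t)" if "t \<noteq> 0"
      unfolding e using that assms by (simp add: fejer_def power_mult_distrib field_simps)
    finally show ?thesis
      using has_integral_combine[of "-L" 0 L f, OF _ _ left[unfolded minus_zero] right] assms
      by (cases "t = 0") (auto simp: fejer_def add.commute)
  qed
  hence "(f has_integral of_real (fejer L t)) UNIV"
    by (rule has_integral_on_superset) (use assms tent_eq_0[of L] in \<open>force simp: f_def\<close>)+
  ultimately show ?thesis
    using has_integral_unique unfolding f_def by blast
qed

subsection \<open>Boundary behaviour of Laplace transforms\<close>

lemma riemann_lebesgue_compact_support:
  fixes f :: "real \<Rightarrow> complex"
  assumes cont: "continuous_on UNIV f" and supp: "\<And>\<tau>. L \<le> \<bar>\<tau>\<bar> \<Longrightarrow> f \<tau> = 0"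
  shows "((\<lambda>y. \<integral>\<tau>. f \<tau> * cis (- (\<tau> * y)) \<partial>lborel) \<longlongrightarrow> 0) at_top"
proof -
  have [measurable]: "f \<in> borel_measurable borel"
    using cont by (rule borel_measurable_continuous_onI)
  have "compact (f ` {-L..L})"
    by (intro compact_continuous_image continuous_on_subset[OF cont]) auto
  then obtain B where B: "\<And>\<tau>. \<tau> \<in> {-L..L} \<Longrightarrow> norm (f \<tau>) \<le> B"
    unfolding compact_eq_bounded_closed bounded_iff by blast
  define B' where "B' = max 0 B"
  have B': "norm (f \<tau>) \<le> B'" for \<tau>
    using B[of \<tau>] supp[of \<tau>] by (cases "\<bar>\<tau>\<bar> \<le> L") (auto simp: B'_def abs_le_iff le_max_iff_disj)
  have ind: "integrable lborel (\<lambda>\<tau>. indicator {a..b} \<tau> * (c::real))" for a b c :: real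
    by (intro integrable_mult_left integrable_real_indicator) (auto simp: emeasure_lborel_Icc_eq)
  have int_f: "integrable lborel f"
  proof (rule Bochner_Integration.integrable_bound[OF ind])
    show "AE \<tau> in lborel. norm (f \<tau>) \<le> norm (indicator {-L..L} \<tau> * B')"
      using B' supp by (intro AE_I2) (force simp: indicator_def B'_def)
  qed auto
  \<comment> \<open>Shifting \<open>\<tau>\<close> by \<open>\<pi> / y\<close> changes the sign of \<open>cis (- \<tau> y)\<close>, so twice the integral is at most \<open>J y\<close>.\<close>
  define J where "J = (\<lambda>y. \<integral>\<tau>. norm (f \<tau> - f (pi / y + 1 * \<tau>)) \<partial>lborel)"
  have "(J \<longlongrightarrow> (\<integral>(\<tau>::real). 0 \<partial>lborel)) at_top"
    unfolding J_def
  proof (rule integral_dominated_convergence_at_top)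
    \<comment> \<open>Once \<open>y \<ge> pi\<close> the shift \<open>pi / y\<close> is at most 1,
      so both terms of the difference vanish outside the support interval enlarged by 1.\<close>
    show "integrable lborel (\<lambda>\<tau>. indicator {-L-1..L+1} \<tau> * (2 * B'))"
      by (rule ind)
    show "AE \<tau> in lborel. ((\<lambda>y. norm (f \<tau> - f (pi / y + 1 * \<tau>))) \<longlongrightarrow> 0) at_top"
    proof (rule AE_I2)
      fix \<tau>
      have "((\<lambda>y. pi / y + 1 * \<tau>) \<longlongrightarrow> 0 + 1 * \<tau>) at_top"
        by (intro tendsto_intros tendsto_divide_0[OF tendsto_const] filterlim_at_top_imp_at_infinity filterlim_ident)
      moreover have "isCont f \<tau>"
        using cont by (auto simp: continuous_on_eq_continuous_at)
      ultimately have "((\<lambda>y. f (pi / y + 1 * \<tau>)) \<longlongrightarrow> f \<tau>) at_top"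
        by (intro isCont_tendsto_compose[where g = f]) auto
      thus "((\<lambda>y. norm (f \<tau> - f (pi / y + 1 * \<tau>))) \<longlongrightarrow> 0) at_top"
        by (intro tendsto_norm_zero) (auto intro!: tendsto_eq_intros)
    qed
    show "\<forall>\<^sub>F y in at_top. AE \<tau> in lborel. norm (norm (f \<tau> - f (pi / y + 1 * \<tau>))) \<le> indicator {-L-1..L+1} \<tau> * (2 * B')"
      using eventually_ge_at_top[of pi]
    proof eventually_elim
      case (elim y)
      have "y > 0" using elim pi_gt_zero by linarith
      hence y: "0 < pi / y" "pi / y \<le> 1"
        using elim by auto
      show ?case
      proof (rule AE_I2)
        fix \<tau>
        show "norm (norm (f \<tau> - f (pi / y + 1 * \<tau>))) \<le> indicator {-L-1..L+1} \<tau> * (2 * B')"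
        proof (cases "\<tau> \<in> {-L-1..L+1}")
          case True
          thus ?thesis
            using norm_triangle_ineq4[of "f \<tau>" "f (pi / y + \<tau>)"] B'[of \<tau>] B'[of "pi / y + \<tau>"] by simp
        next
          case False
          hence "f \<tau> = 0" "f (pi / y + \<tau>) = 0"
            using y by (auto intro!: supp)
          thus ?thesis by (simp add: B'_def)
        qed
      qed
    qed
  qed auto
  hence "(J \<longlongrightarrow> 0) at_top" by simp
  moreover have "\<forall>\<^sub>F y in at_top. norm (\<integral>\<tau>. f \<tau> * cis (- (\<tau> * y)) \<partial>lborel) \<le> J y"
    using eventually_gt_at_top[of 0]
  proof eventually_elim
    case (elim y)
    define I where "I = (\<integral>\<tau>. f \<tau> * cis (- (\<tau> * y)) \<partial>lborel)"
    have int_cis: "integrable lborel (\<lambda>\<tau>. h \<tau> * cis (- (\<tau> * y)))" if "integrable lborel h" for h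
      by (rule Bochner_Integration.integrable_bound[OF that]) (use that in \<open>auto simp: norm_mult\<close>)
    have int_shift: "integrable lborel (\<lambda>\<tau>. f (pi / y + 1 * \<tau>))"
      by (rule lborel_integrable_real_affine[OF int_f]) auto
    have "I = (\<integral>\<tau>. f (pi / y + 1 * \<tau>) * cis (- ((pi / y + 1 * \<tau>) * y)) \<partial>lborel)"
      unfolding I_def by (subst lborel_integral_real_affine[of 1 _ "pi / y"]) auto
    also have "(\<lambda>\<tau>. cis (- ((pi / y + 1 * \<tau>) * y))) = (\<lambda>\<tau>. - cis (- (\<tau> * y)))"
    proof
      fix \<tau>
      have "- ((pi / y + 1 * \<tau>) * y) = - pi + - (\<tau> * y)"
        using elim by (simp add: field_simps)
      thus "cis (- ((pi / y + 1 * \<tau>) * y)) = - cis (- (\<tau> * y))"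
        by (simp only: cis_mult [symmetric]) (simp add: complex_eq_iff)
    qed
    hence "(\<integral>\<tau>. f (pi / y + 1 * \<tau>) * cis (- ((pi / y + 1 * \<tau>) * y)) \<partial>lborel)
        = (\<integral>\<tau>. - (f (pi / y + 1 * \<tau>) * cis (- (\<tau> * y))) \<partial>lborel)"
      unfolding fun_eq_iff by simp
    finally have "I = - (\<integral>\<tau>. f (pi / y + 1 * \<tau>) * cis (- (\<tau> * y)) \<partial>lborel)"
      by simp
    hence "I + I = (\<integral>\<tau>. f \<tau> * cis (- (\<tau> * y)) \<partial>lborel) - (\<integral>\<tau>. f (pi / y + 1 * \<tau>) * cis (- (\<tau> * y)) \<partial>lborel)"
      by (simp add: I_def)
    also have "\<dots> = (\<integral>\<tau>. (f \<tau> - f (pi / y + 1 * \<tau>)) * cis (- (\<tau> * y)) \<partial>lborel)"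
      using int_cis[OF int_f] int_cis[OF int_shift] by (simp add: algebra_simps)
    also have "norm \<dots> \<le> (\<integral>\<tau>. norm ((f \<tau> - f (pi / y + 1 * \<tau>)) * cis (- (\<tau> * y))) \<partial>lborel)"
      by (rule integral_norm_bound)
    also have "\<dots> = J y" by (simp add: J_def norm_mult)
    finally have "norm (I + I) \<le> J y" .
    moreover have "norm (I + I) = 2 * norm I" by (metis mult_2 norm_mult norm_numeral)
    ultimately have "norm I \<le> J y" using norm_ge_zero[of I] by linarith
    thus ?case by (simp add: I_def)
  qed
  ultimately show ?thesis
    by (rule Lim_null_comparison[rotated])
qed

text \<open>Fubini after inserting \<open>integral_tent_cis\<close>. A Fejer mean of
  \<open>g\<close> thus sees the Fourier transform of \<open>g\<close> only on
  \<open>{-L..L}\<close>, which is what uniform convergence on compact sets can control.\<close>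

lemma integral_mult_fejer:
  fixes g :: "real \<Rightarrow> real"
  assumes g: "integrable lborel g" and "L > 0"
  shows "of_real (\<integral>t. g t * fejer L (t - y) \<partial>lborel) =
    (\<integral>\<tau>. of_real (tent L \<tau>) * (cis (- (\<tau> * y)) * (\<integral>t. of_real (g t) * cis (\<tau> * t) \<partial>lborel)) \<partial>lborel)"
proof -
  have [measurable]: "g \<in> borel_measurable borel" using g by auto
  define F where "F = (\<lambda>t \<tau>. of_real (g t) * (of_real (tent L \<tau>) * cis (\<tau> * (t - y))))"
  have F_meas [measurable]: "case_prod F \<in> borel_measurable (lborel \<Otimes>\<^sub>M lborel)"
    unfolding F_def by measurable
  have inner: "integrable lborel (F t)" for t
    unfolding F_def using assms by (intro integrable_mult_right integrable_tent_mult[of _ _ 1]) auto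
  have "integrable (lborel \<Otimes>\<^sub>M lborel) (case_prod F)"
  proof (rule lborel_pair.Fubini_integrable)
    have "(\<lambda>t. \<integral>\<tau>. norm (case (t, \<tau>) of (t, \<tau>) \<Rightarrow> F t \<tau>) \<partial>lborel) = (\<lambda>t. \<bar>g t\<bar> * (\<integral>\<tau>. tent L \<tau> \<partial>lborel))"
      by (simp add: F_def norm_mult tent_nonneg abs_of_nonneg)
    thus "integrable lborel (\<lambda>t. \<integral>\<tau>. norm (case (t, \<tau>) of (t, \<tau>) \<Rightarrow> F t \<tau>) \<partial>lborel)"
      using g by simp
  qed (use inner in auto)
  from lborel_pair.Fubini_integral[OF this]
  have Fub: "(\<integral>\<tau>. (\<integral>t. F t \<tau> \<partial>lborel) \<partial>lborel) = (\<integral>t. (\<integral>\<tau>. F t \<tau> \<partial>lborel) \<partial>lborel)"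
    by simp
  have "complex_of_real (\<integral>t. g t * fejer L (t - y) \<partial>lborel) = (\<integral>t. of_real (g t) * of_real (fejer L (t - y)) \<partial>lborel)"
    by (simp flip: integral_complex_of_real)
  also have "\<dots> = (\<integral>t. (\<integral>\<tau>. F t \<tau> \<partial>lborel) \<partial>lborel)"
    unfolding integral_tent_cis[OF \<open>L > 0\<close>, symmetric] F_def by simp
  also have "\<dots> = (\<integral>\<tau>. (\<integral>t. F t \<tau> \<partial>lborel) \<partial>lborel)" by (rule Fub[symmetric])
  also have "(\<lambda>\<tau>. \<integral>t. F t \<tau> \<partial>lborel) = (\<lambda>\<tau>. of_real (tent L \<tau>) * (cis (- (\<tau> * y)) * (\<integral>t. of_real (g t) * cis (\<tau> * t) \<partial>lborel)))"
  proof
    fix \<tau>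
    have "F t \<tau> = of_real (tent L \<tau>) * cis (- (\<tau> * y)) * (of_real (g t) * cis (\<tau> * t))" for t
      by (simp add: F_def cis_mult algebra_simps)
    thus "(\<integral>t. F t \<tau> \<partial>lborel) = of_real (tent L \<tau>) * (cis (- (\<tau> * y)) * (\<integral>t. of_real (g t) * cis (\<tau> * t) \<partial>lborel))"
      by (simp add: mult.assoc)
  qed
  finally show ?thesis .
qed

lemma continuous_on_fourier_integral:
  fixes g :: "real \<Rightarrow> real"
  assumes g: "integrable lborel g"
  shows "continuous_on A (\<lambda>\<tau>. \<integral>t. of_real (g t) * cis (\<tau> * t) \<partial>lborel)"
proof (rule continuous_on_subset)
  have [measurable]: "g \<in> borel_measurable borel" using g by auto
  show "continuous_on UNIV (\<lambda>\<tau>. \<integral>t. of_real (g t) * cis (\<tau> * t) \<partial>lborel)"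
    unfolding continuous_on_sequentially
  proof (intro ballI allI impI, elim conjE)
    fix X :: "nat \<Rightarrow> real" and \<tau> assume X: "X \<longlonglongrightarrow> \<tau>"
    show "((\<lambda>\<tau>. \<integral>t. of_real (g t) * cis (\<tau> * t) \<partial>lborel) \<circ> X) \<longlonglongrightarrow> (\<integral>t. of_real (g t) * cis (\<tau> * t) \<partial>lborel)"
      unfolding o_def
    proof (rule integral_dominated_convergence)
      show "integrable lborel (\<lambda>t. norm (g t))" using g by simp
      show "AE t in lborel. (\<lambda>n. of_real (g t) * cis (X n * t)) \<longlonglongrightarrow> of_real (g t) * cis (\<tau> * t)"
        unfolding cis_conv_exp by (intro AE_I2 tendsto_intros X)
    qed (auto simp: norm_mult)
  qed
qed auto

text \<open>The coupling x = 1/y turns two limits into one. By uniformity the mean differs little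
  from the Fourier integral of the boundary function weighted by the tent, and that integral
  vanishes in the limit by Riemann-Lebesgue.\<close>

lemma fejer_mean_tendsto_0:
  fixes G :: "real \<Rightarrow> real" and l :: "real \<Rightarrow> complex"
  assumes "L > 0" "\<sigma> > 0"
    and int: "\<And>x. 0 < x \<Longrightarrow> x < \<sigma> \<Longrightarrow> integrable lborel (\<lambda>t. G t * exp (- x * t))"
    and lim: "uniform_limit {-L..L} (\<lambda>x \<tau>. \<integral>t. of_real (G t * exp (- x * t)) * cis (\<tau> * t) \<partial>lborel) l (at_right 0)"
  shows "((\<lambda>y. \<integral>t. G t * exp (- t / y) * fejer L (t - y) \<partial>lborel) \<longlongrightarrow> 0) at_top"
proof -
  define T where "T = (\<lambda>x \<tau>. \<integral>t. of_real (G t * exp (- x * t)) * cis (\<tau> * t) \<partial>lborel)"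
  have T_cont: "continuous_on A (T x)" if "0 < x" "x < \<sigma>" for x A
    unfolding T_def by (intro continuous_on_fourier_integral int that)
  have ev_x: "\<forall>\<^sub>F x in at_right 0. 0 < x \<and> x < \<sigma>"
    unfolding eventually_at_right_field using \<open>\<sigma> > 0\<close> by auto
  have l_cont: "continuous_on {-L..L} l"
    by (rule uniform_limit_theorem[OF _ lim[folded T_def]])
       (use ev_x T_cont in \<open>auto elim!: eventually_mono\<close>)
  \<comment> \<open>\<open>l\<close> is only known to be continuous on \<open>{-L..L}\<close>, while Riemann--Lebesgue needs a continuous
    function on the whole line.\<close>
  define clamp where "clamp = (\<lambda>\<tau>. max (-L) (min L \<tau>))"
  have clamp: "clamp \<tau> \<in> {-L..L}" "\<bar>\<tau>\<bar> \<le> L \<Longrightarrow> clamp \<tau> = \<tau>" for \<tau>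
    using \<open>L > 0\<close> by (auto simp: clamp_def)
  define f where "f = (\<lambda>\<tau>. of_real (tent L \<tau>) * l (clamp \<tau>))"
  have f_eq: "f \<tau> = of_real (tent L \<tau>) * l \<tau>" for \<tau>
    using tent_eq_0[of L \<tau>] clamp(2)[of \<tau>] \<open>L > 0\<close> unfolding f_def by (cases "\<bar>\<tau>\<bar> \<le> L") auto
  have "continuous_on UNIV clamp" unfolding clamp_def by (intro continuous_intros)
  hence "continuous_on UNIV (l \<circ> clamp)"
    by (rule continuous_on_compose) (use clamp in \<open>auto intro: continuous_on_subset[OF l_cont]\<close>)
  hence lc: "continuous_on UNIV (\<lambda>\<tau>. l (clamp \<tau>))" by (simp add: o_def)
  hence f_cont: "continuous_on UNIV f"
    unfolding f_def by (intro continuous_intros)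
  have [measurable]: "(\<lambda>\<tau>. l (clamp \<tau>)) \<in> borel_measurable borel"
    using lc by (rule borel_measurable_continuous_onI)
  have RL: "((\<lambda>y. \<integral>\<tau>. f \<tau> * cis (- (\<tau> * y)) \<partial>lborel) \<longlongrightarrow> 0) at_top"
    by (rule riemann_lebesgue_compact_support[OF f_cont, of L]) (use tent_eq_0 \<open>L > 0\<close> in \<open>auto simp: f_def\<close>)
  have bounded_on: "\<exists>B. \<forall>\<tau>\<in>{-L..L}. norm (h \<tau>) \<le> B" if "continuous_on {-L..L} h" for h :: "real \<Rightarrow> complex"
    using compact_continuous_image[OF that compact_Icc] unfolding compact_eq_bounded_closed bounded_iff by blast
  have inv: "filterlim (\<lambda>y::real. 1 / y) (at_right 0) at_top"
    by (simp add: filterlim_inverse_at_right_top flip: inverse_eq_divide)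
  define N where "N = (\<lambda>y. \<integral>t. G t * exp (- t / y) * fejer L (t - y) \<partial>lborel)"
  have "((\<lambda>y. of_real (N y) - (\<integral>\<tau>. f \<tau> * cis (- (\<tau> * y)) \<partial>lborel)) \<longlongrightarrow> 0) at_top"
  proof (rule tendstoI)
    fix e :: real assume "e > 0"
    \<comment> \<open>An error \<open>d\<close> integrated over \<open>{-L..L}\<close> costs
      \<open>2 * L * d\<close>, which is half of \<open>e\<close>.\<close>
    define d where "d = e / (4 * L)"
    have "d > 0" using \<open>e > 0\<close> \<open>L > 0\<close> by (simp add: d_def)
    have "\<forall>\<^sub>F x in at_right 0. (0 < x \<and> x < \<sigma>) \<and> (\<forall>\<tau>\<in>{-L..L}. dist (T x \<tau>) (l \<tau>) < d)"
      using uniform_limitD[OF lim[folded T_def] \<open>d > 0\<close>] ev_x by eventually_elim auto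
    from eventually_compose_filterlim[OF this inv] eventually_gt_at_top[of 0]
    show "\<forall>\<^sub>F y in at_top. dist (of_real (N y) - (\<integral>\<tau>. f \<tau> * cis (- (\<tau> * y)) \<partial>lborel)) 0 < e"
    proof eventually_elim
      case (elim y)
      define x where "x = 1 / y"
      have x: "0 < x" "x < \<sigma>" using elim by (auto simp: x_def)
      have close: "norm (T x \<tau> - l \<tau>) \<le> d" if "\<bar>\<tau>\<bar> \<le> L" for \<tau>
      proof -
        have "\<tau> \<in> {-L..L}" using that by (auto simp: abs_le_iff)
        with elim have "dist (T x \<tau>) (l \<tau>) < d" by (simp add: x_def)
        thus ?thesis by (simp add: dist_norm)
      qed
      have [measurable]: "T x \<in> borel_measurable borel"
        by (intro borel_measurable_continuous_onI T_cont x)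
      obtain B1 where B1: "\<And>\<tau>. \<tau> \<in> {-L..L} \<Longrightarrow> norm (T x \<tau>) \<le> B1"
        using bounded_on[OF T_cont[OF x]] by blast
      obtain B2 where B2: "\<And>\<tau>. \<tau> \<in> {-L..L} \<Longrightarrow> norm (l \<tau>) \<le> B2"
        using bounded_on[OF l_cont] by blast
      have i1: "integrable lborel (\<lambda>\<tau>. of_real (tent L \<tau>) * (cis (- (\<tau> * y)) * T x \<tau>))"
        by (rule integrable_tent_mult[of _ _ B1]) (use \<open>L > 0\<close> B1 in \<open>auto simp: norm_mult abs_le_iff\<close>)
      have i2: "integrable lborel (\<lambda>\<tau>. of_real (tent L \<tau>) * (l (clamp \<tau>) * cis (- (\<tau> * y))))"
        by (rule integrable_tent_mult[of _ _ B2]) (use \<open>L > 0\<close> B2 clamp in \<open>auto simp: norm_mult abs_le_iff\<close>)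
      have "of_real (N y) = (\<integral>\<tau>. of_real (tent L \<tau>) * (cis (- (\<tau> * y)) * T x \<tau>) \<partial>lborel)"
        using integral_mult_fejer[OF int[OF x] \<open>L > 0\<close>, of y] by (simp add: N_def T_def x_def)
      hence "of_real (N y) - (\<integral>\<tau>. f \<tau> * cis (- (\<tau> * y)) \<partial>lborel) =
         (\<integral>\<tau>. of_real (tent L \<tau>) * (cis (- (\<tau> * y)) * T x \<tau>) -
            of_real (tent L \<tau>) * (l (clamp \<tau>) * cis (- (\<tau> * y))) \<partial>lborel)"
        using i1 i2 by (simp add: f_def mult.assoc)
      also have "norm \<dots> \<le> (\<integral>\<tau>. indicator {-L..L} \<tau> * d \<partial>lborel)"
      proof (rule Bochner_Integration.integral_norm_bound_integral)
        show "integrable lborel (\<lambda>\<tau>. indicator {-L..L} \<tau> * d)"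
          by (intro integrable_mult_left integrable_real_indicator) (auto simp: emeasure_lborel_Icc_eq)
        fix \<tau> :: real
        have "norm (of_real (tent L \<tau>) * (cis (- (\<tau> * y)) * T x \<tau>) -
            of_real (tent L \<tau>) * (l (clamp \<tau>) * cis (- (\<tau> * y)))) =
            norm (of_real (tent L \<tau>) * (cis (- (\<tau> * y)) * (T x \<tau> - l (clamp \<tau>))))"
          by (simp add: algebra_simps)
        also have "\<dots> = tent L \<tau> * norm (T x \<tau> - l (clamp \<tau>))"
          by (simp add: norm_mult tent_nonneg)
        also have "\<dots> \<le> indicator {-L..L} \<tau> * d"
        proof (cases "\<bar>\<tau>\<bar> \<le> L")
          case True
          thus ?thesis using clamp(2)[of \<tau>] close[of \<tau>] \<open>d > 0\<close>
            by (intro mult_mono tent_le_indicator \<open>L > 0\<close>) auto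
        next
          case False
          thus ?thesis using tent_eq_0[of L \<tau>] \<open>L > 0\<close> \<open>d > 0\<close> by simp
        qed
        finally show "norm (of_real (tent L \<tau>) * (cis (- (\<tau> * y)) * T x \<tau>) -
            of_real (tent L \<tau>) * (l (clamp \<tau>) * cis (- (\<tau> * y)))) \<le> indicator {-L..L} \<tau> * d" .
      qed (use i1 i2 in auto)
      also have "\<dots> = 2 * L * d" using \<open>L > 0\<close> by simp
      also have "\<dots> < e" using \<open>e > 0\<close> \<open>L > 0\<close> by (simp add: d_def field_simps)
      finally show ?case by simp
    qed
  qed
  from tendsto_add[OF this RL] have "((\<lambda>y. complex_of_real (N y)) \<longlongrightarrow> complex_of_real 0) at_top" by simp
  thus ?thesis unfolding tendsto_of_real_iff N_def .
qed

subsection \<open>Tauberian theorem\<close>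

text \<open>Raise \<open>s / (a + 1) \<le> exp (s / (a + 1))\<close> to the power \<open>a\<close>.
  Dividing by \<open>a + 1\<close> instead of \<open>a\<close> also covers
  \<open>a = 0\<close>.\<close>

lemma powr_le_exp:
  fixes a s :: real
  assumes "a \<ge> 0" "s \<ge> 0"
  shows "s powr a \<le> (a + 1) powr a * exp s"
proof (cases "s = 0")
  case False
  hence "s > 0" using assms by simp
  have "s / (a + 1) \<le> exp (s / (a + 1))"
    using exp_ge_add_one_self[of "s / (a + 1)"] by linarith
  hence "(s / (a + 1)) powr a \<le> exp (s / (a + 1)) powr a"
    using assms by (intro powr_mono2) auto
  also have "\<dots> = exp (a * (s / (a + 1)))"
    by (simp add: powr_def)
  also have "a * (s / (a + 1)) \<le> s"
    using assms by (simp add: field_simps)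
  finally show ?thesis
    using assms by (simp add: powr_divide field_simps)
qed auto

text \<open>After rescaling, this integral is the damped kernel mean of t^a divided by y^a. The
  damping keeps \<open>q\<close> bounded, so a multiple of \<open>K\<close> dominates even if t^a
  times \<open>K\<close> is not integrable.\<close>

lemma powr_exp_mean_tendsto:
  fixes a L :: real and K :: "real \<Rightarrow> real"
  assumes "a \<ge> 0" "L > 0" and K: "integrable lborel K"
  defines "q \<equiv> (\<lambda>s. indicator {0..} s * s powr a * exp (- s))"
  shows "((\<lambda>y. \<integral>u. q (1 + u / (L * y)) * K u \<partial>lborel) \<longlongrightarrow> exp (- 1) * integral\<^sup>L lborel K) at_top"
proof -
  have [measurable]: "q \<in> borel_measurable borel" unfolding q_def by measurable
  have [measurable]: "K \<in> borel_measurable borel" using K by auto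
  have q_bound: "\<bar>q s\<bar> \<le> (a + 1) powr a" for s
    using powr_le_exp[of a s] assms by (auto simp: q_def indicator_def exp_minus field_simps)
  have cont: "isCont (\<lambda>s. s powr a * exp (- s)) 1"
    by (intro continuous_intros) auto
  have "\<forall>\<^sub>F s::real in nhds 1. s > 0"
    by (rule order_tendstoD(1)[OF filterlim_ident]) auto
  hence "\<forall>\<^sub>F s in nhds 1. s powr a * exp (- s) = q s"
    by eventually_elim (auto simp: q_def)
  hence "isCont q 1" using cont by (rule isCont_cong[THEN iffD1])
  hence "((\<lambda>y. \<integral>u. q (1 + u / (L * y)) * K u \<partial>lborel) \<longlongrightarrow> (\<integral>u. q 1 * K u \<partial>lborel)) at_top"
  proof (intro integral_dominated_convergence_at_top)
    show "integrable lborel (\<lambda>u. (a + 1) powr a * \<bar>K u\<bar>)" using K by auto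
    show "AE u in lborel. ((\<lambda>y. q (1 + u / (L * y)) * K u) \<longlongrightarrow> q 1 * K u) at_top" if "isCont q 1"
    proof (rule AE_I2)
      fix u
      have "filterlim (\<lambda>y. L * y) at_top at_top"
        using \<open>L > 0\<close> by (rule filterlim_tendsto_pos_mult_at_top[OF tendsto_const]) (rule filterlim_ident)
      hence "((\<lambda>y. 1 + u / (L * y)) \<longlongrightarrow> 1 + 0) at_top"
        by (intro tendsto_intros tendsto_divide_0[OF tendsto_const] filterlim_at_top_imp_at_infinity)
      thus "((\<lambda>y. q (1 + u / (L * y)) * K u) \<longlongrightarrow> q 1 * K u) at_top"
        using that by (intro tendsto_intros isCont_tendsto_compose[where g = q]) auto
    qed
    show "\<forall>\<^sub>F y in at_top. AE u in lborel. norm (q (1 + u / (L * y)) * K u) \<le> (a + 1) powr a * \<bar>K u\<bar>"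
      using q_bound by (auto simp: abs_mult intro!: always_eventually AE_I2 mult_right_mono)
  qed auto
  thus ?thesis by (simp add: q_def)
qed

text \<open>The bound on \<open>p s\<close> in terms of \<open>p t\<close> makes \<open>p\<close>
  nearly constant, up to a factor, on short intervals, so a narrow kernel mean pins down
  \<open>p y\<close>. The order matters: restricting the mean to its core bounds \<open>p\<close>
  from above, this yields a crude growth bound, and the growth bound then controls the tails for the
  estimate from below.\<close>

lemma tauberian_kernel:
  fixes p K :: "real \<Rightarrow> real" and a c M :: real
  assumes p_nonneg: "\<And>t. p t \<ge> 0" and p_neg: "\<And>t. t < 0 \<Longrightarrow> p t = 0"
    and p_lip: "\<And>s t. 0 \<le> s \<Longrightarrow> 0 \<le> t \<Longrightarrow> p s \<le> exp (M * \<bar>s - t\<bar>) * p t"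
    and "M \<ge> 0" "a \<ge> 0"
    and K_nonneg: "\<And>u. K u \<ge> 0" and K: "integrable lborel K" and K_pos: "integral\<^sup>L lborel K > 0"
    and int: "\<And>L. L > 0 \<Longrightarrow> \<forall>\<^sub>F y in at_top. integrable lborel (\<lambda>u. p (y + u / L) * exp (- (1 + u / (L * y))) * K u)"
    and lim: "\<And>L. L > 0 \<Longrightarrow> 
      ((\<lambda>y. (\<integral>u. p (y + u / L) * exp (- (1 + u / (L * y))) * K u \<partial>lborel) / y powr a) \<longlongrightarrow>
         c * exp (- 1) * integral\<^sup>L lborel K) at_top"
  shows "((\<lambda>y. p y / y powr a) \<longlongrightarrow> c) at_top"
proof -
  define I where "I = integral\<^sup>L lborel K"
  define b where "b = c * exp (- 1) * I"
  define A where "A = (\<lambda>L y. (\<integral>u. p (y + u / L) * exp (- (1 + u / (L * y))) * K u \<partial>lborel) / y powr a)"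
  \<comment> \<open>Below the kernel is scaled by \<open>L = n\<^sup>2\<close> and its argument cut at \<open>|u| \<le> n\<close>: there \<open>p\<close> is evaluated
    within \<open>1 / n\<close> of \<open>y\<close>, while \<open>J n\<close> exhausts the mass of \<open>K\<close>.\<close>
  define J where "J = (\<lambda>n::nat. \<integral>u. indicator {- real n..real n} u * K u \<partial>lborel)"
  have [measurable]: "K \<in> borel_measurable borel" using K by auto
  have int_ind: "integrable lborel (\<lambda>u. indicator S u * K u)" if "S \<in> sets borel" for S
    using integrable_mult_indicator[of S lborel K] K that by simp
  have J_lim: "J \<longlonglongrightarrow> I" unfolding J_def I_def
  proof (rule integral_dominated_convergence)
    show "integrable lborel (\<lambda>u. \<bar>K u\<bar>)" using K by auto
    show "AE u in lborel. (\<lambda>n. indicator {- real n..real n} u * K u) \<longlonglongrightarrow> K u"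
    proof (rule AE_I2)
      fix u
      have "\<forall>\<^sub>F n in sequentially. real n \<ge> \<bar>u\<bar>"
        using filterlim_real_sequentially by (auto simp: filterlim_at_top)
      hence "\<forall>\<^sub>F n in sequentially. indicator {- real n..real n} u * K u = K u"
        by eventually_elim (auto simp: indicator_def)
      thus "(\<lambda>n. indicator {- real n..real n} u * K u) \<longlonglongrightarrow> K u"
        by (rule tendsto_eventually)
    qed
  qed (auto simp: indicator_def)
  have "I > 0" using K_pos by (simp add: I_def)
  have J_pos: "\<forall>\<^sub>F n in sequentially. J n > 0"
    by (rule order_tendstoD(1)[OF J_lim \<open>I > 0\<close>])
  have A_lim: "(A L \<longlongrightarrow> b) at_top" if "L > 0" for L
    using lim[OF that] by (simp add: A_def b_def I_def)
  have near: "0 \<le> y + u / (real n)\<^sup>2" "\<bar>u / (real n)\<^sup>2\<bar> \<le> 1 / n" "\<bar>u / ((real n)\<^sup>2 * y)\<bar> \<le> 1 / n"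
    if "n > 0" "y \<ge> 1" "u \<in> {- real n..real n}" for n :: nat and y u :: real
  proof -
    have "\<bar>u\<bar> * real n \<le> real n * real n" using that by (intro mult_right_mono) auto
    thus *: "\<bar>u / (real n)\<^sup>2\<bar> \<le> 1 / n" using that by (simp add: field_simps power2_eq_square)
    have "1 / real n \<le> 1" using that by simp
    thus "0 \<le> y + u / (real n)\<^sup>2" using * that by linarith
    have "\<bar>u / ((real n)\<^sup>2 * y)\<bar> = \<bar>u / (real n)\<^sup>2\<bar> / y" using that by (simp add: abs_mult)
    also have "\<dots> \<le> \<bar>u / (real n)\<^sup>2\<bar> / 1" using that by (intro divide_left_mono) auto
    finally show "\<bar>u / ((real n)\<^sup>2 * y)\<bar> \<le> 1 / n" using * by simp
  qed
  \<comment> \<open>Positivity allows discarding \<open>u\<close> outside the core. There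
    \<open>p_lip\<close> loses a factor exp(M/n) and the damping a factor exp(1/n), hence
    \<open>(M + 1) / n\<close>.\<close>
  have upper: "\<forall>\<^sub>F y in at_top. p y / y powr a * (exp (- 1 - (M + 1) / n) * J n) \<le> A ((real n)\<^sup>2) y"
    if "n > 0" for n :: nat
    using int[of "(real n)\<^sup>2", simplified, OF that] eventually_ge_at_top[of 1]
  proof eventually_elim
    case (elim y)
    have "(\<integral>u. p y * exp (- 1 - (M + 1) / n) * (indicator {- real n..real n} u * K u) \<partial>lborel) \<le>
          (\<integral>u. p (y + u / (real n)\<^sup>2) * exp (- (1 + u / ((real n)\<^sup>2 * y))) * K u \<partial>lborel)"
    proof (rule integral_mono)
      show "p y * exp (- 1 - (M + 1) / n) * (indicator {- real n..real n} u * K u) \<le>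
          p (y + u / (real n)\<^sup>2) * exp (- (1 + u / ((real n)\<^sup>2 * y))) * K u" for u
      proof (cases "u \<in> {- real n..real n}")
        case True
        note near = near[OF \<open>n > 0\<close> \<open>y \<ge> 1\<close> True]
        have "p y \<le> exp (M * \<bar>y - (y + u / (real n)\<^sup>2)\<bar>) * p (y + u / (real n)\<^sup>2)"
          using near elim by (intro p_lip) auto
        also have "\<dots> \<le> exp (M * (1 / n)) * p (y + u / (real n)\<^sup>2)"
          using near \<open>M \<ge> 0\<close> by (intro mult_right_mono p_nonneg iffD2[OF exp_le_cancel_iff] mult_left_mono) auto
        finally have "p y * exp (- 1 - (M + 1) / n) \<le> (exp (M * (1 / n)) * p (y + u / (real n)\<^sup>2)) * exp (- 1 - (M + 1) / n)"
          by (intro mult_right_mono) auto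
        also have "\<dots> = p (y + u / (real n)\<^sup>2) * exp (M * (1 / n) + (- 1 - (M + 1) / n))"
          unfolding exp_add by simp
        also have "M * (1 / n) + (- 1 - (M + 1) / n) = - (1 + 1 / n)"
          by (simp add: add_divide_distrib)
        also have "p (y + u / (real n)\<^sup>2) * exp (- (1 + 1 / n)) \<le> p (y + u / (real n)\<^sup>2) * exp (- (1 + u / ((real n)\<^sup>2 * y)))"
          using abs_le_D1[OF near(3)] by (intro mult_left_mono p_nonneg iffD2[OF exp_le_cancel_iff]) linarith+
        finally show ?thesis using True by (simp add: mult_right_mono K_nonneg)
      next
        case False
        thus ?thesis by (simp add: p_nonneg K_nonneg)
      qed
    qed (use elim int_ind in auto)
    also have "(\<integral>u. p y * exp (- 1 - (M + 1) / n) * (indicator {- real n..real n} u * K u) \<partial>lborel)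
      = p y * exp (- 1 - (M + 1) / n) * J n"
      by (simp add: J_def)
    finally show ?case using elim by (simp add: A_def divide_right_mono)
  qed
  \<comment> \<open>One fixed \<open>n\<close> in \<open>upper\<close> gives p(t) = O(t^a) for large
    \<open>t\<close>, while \<open>p_lip\<close> from the origin covers bounded \<open>t\<close>. By
    \<open>powr_le_exp\<close> the damping trades t^a for y^a, so the bound is uniform in
    \<open>t\<close>.\<close>
  obtain Cb where Cb: "Cb \<ge> 0" "\<And>t y. t \<ge> 0 \<Longrightarrow> y \<ge> 1 \<Longrightarrow> p t * exp (- (t / y)) \<le> Cb * y powr a"
  proof -
    obtain n where n: "n > 0" "J n > 0"
      using eventually_conj[OF J_pos eventually_gt_at_top[of 0]] by (auto dest: eventually_happens)
    define e where "e = exp (- 1 - (M + 1) / n) * J n"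
    have "e > 0" using n by (simp add: e_def)
    have "\<forall>\<^sub>F y in at_top. A ((real n)\<^sup>2) y < b + 1"
      using n by (intro order_tendstoD(2)[OF A_lim]) auto
    with upper[OF n(1)] have "\<forall>\<^sub>F y in at_top. p y / y powr a * e \<le> b + 1"
      by eventually_elim (auto simp: e_def)
    then obtain Y where Y: "\<And>y. y \<ge> Y \<Longrightarrow> p y / y powr a * e \<le> b + 1"
      by (auto simp: eventually_at_top_linorder)
    \<comment> \<open>\<open>c\<close> carries no sign assumption, so the maximum with 0 secures
      \<open>R \<ge> 0\<close>.\<close>
    define R where "R = max 0 ((b + 1) / e)"
    define Y' where "Y' = max 1 Y"
    have R: "p t \<le> R * t powr a" if "t \<ge> Y'" for t
    proof -
      have t: "t \<ge> Y" "t powr a > 0" using that by (auto simp: Y'_def)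
      have "p t / t powr a \<le> (b + 1) / e"
        using Y[OF t(1)] \<open>e > 0\<close> by (simp add: field_simps)
      also have "\<dots> \<le> R" by (simp add: R_def)
      finally show ?thesis using t(2) by (simp add: field_simps)
    qed
    show ?thesis
    proof (rule that[of "exp (M * Y') * p 0 + R * (a + 1) powr a"])
      show "0 \<le> exp (M * Y') * p 0 + R * (a + 1) powr a" by (simp add: R_def p_nonneg)
      fix t y :: real assume ty: "t \<ge> 0" "y \<ge> 1"
      have ypow: "y powr a \<ge> 1" using ty \<open>a \<ge> 0\<close> by (simp add: ge_one_powr_ge_zero)
      show "p t * exp (- (t / y)) \<le> (exp (M * Y') * p 0 + R * (a + 1) powr a) * y powr a"
      proof (cases "t \<ge> Y'")
        case True
        have "p t * exp (- (t / y)) \<le> R * t powr a * exp (- (t / y))"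
          using R[OF True] by (intro mult_right_mono) auto
        also have "t powr a = (t / y) powr a * y powr a"
          using ty by (simp add: powr_divide)
        also have "R * ((t / y) powr a * y powr a) * exp (- (t / y)) = R * ((t / y) powr a * exp (- (t / y))) * y powr a"
          by simp
        also have "(t / y) powr a * exp (- (t / y)) \<le> (a + 1) powr a"
          using powr_le_exp[OF \<open>a \<ge> 0\<close>, of "t / y"] ty by (simp add: exp_minus field_simps)
        hence "R * ((t / y) powr a * exp (- (t / y))) * y powr a \<le> R * (a + 1) powr a * y powr a"
          by (intro mult_right_mono mult_left_mono) (auto simp: R_def)
        also have "\<dots> \<le> (exp (M * Y') * p 0 + R * (a + 1) powr a) * y powr a"
          by (intro mult_right_mono) (auto simp: p_nonneg)
        finally show ?thesis .
      next
        case False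
        have "p t * exp (- (t / y)) \<le> p t * 1"
          using ty by (intro mult_left_mono p_nonneg) auto
        also have "p t \<le> exp (M * \<bar>t - 0\<bar>) * p 0" using ty by (intro p_lip) auto
        also have "\<dots> \<le> exp (M * Y') * p 0"
          using False ty \<open>M \<ge> 0\<close> by (intro mult_right_mono p_nonneg iffD2[OF exp_le_cancel_iff] mult_left_mono) auto
        also have "\<dots> \<le> exp (M * Y') * p 0 + R * (a + 1) powr a" by (simp add: R_def)
        also have "\<dots> \<le> (exp (M * Y') * p 0 + R * (a + 1) powr a) * y powr a"
          using mult_left_mono[OF ypow, of "exp (M * Y') * p 0 + R * (a + 1) powr a"]
          by (simp add: R_def p_nonneg)
        finally show ?thesis by simp
      qed
    qed
  qed
  \<comment> \<open>The part beyond the core has kernel mass \<open>I - J n\<close>, and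
    \<open>Cb\<close> does not depend on \<open>n\<close>, so the tail is negligible relative to y^a
    for large \<open>n\<close>.\<close>
  have lower: "\<forall>\<^sub>F y in at_top. A ((real n)\<^sup>2) y \<le> p y / y powr a * (exp (- 1 + (M + 1) / n) * J n) + Cb * (I - J n)"
    if "n > 0" for n :: nat
    using int[of "(real n)\<^sup>2", simplified, OF that] eventually_ge_at_top[of 1]
  proof eventually_elim
    case (elim y)
    define S where "S = {- real n..real n}"
    have [measurable]: "S \<in> sets borel" by (simp add: S_def)
    have "(\<integral>u. p (y + u / (real n)\<^sup>2) * exp (- (1 + u / ((real n)\<^sup>2 * y))) * K u \<partial>lborel) \<le> 
          (\<integral>u. p y * exp (- 1 + (M + 1) / n) * (indicator S u * K u) + 
                Cb * y powr a * (K u - indicator S u * K u) \<partial>lborel)"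
    proof (rule integral_mono)
      show "p (y + u / (real n)\<^sup>2) * exp (- (1 + u / ((real n)\<^sup>2 * y))) * K u \<le> 
         p y * exp (- 1 + (M + 1) / n) * (indicator S u * K u) + Cb * y powr a * (K u - indicator S u * K u)" for u
      proof (cases "u \<in> {- real n..real n}")
        case True
        note near = near[OF \<open>n > 0\<close> \<open>y \<ge> 1\<close> True]
        have "p (y + u / (real n)\<^sup>2) \<le> exp (M * \<bar>(y + u / (real n)\<^sup>2) - y\<bar>) * p y"
          using near elim by (intro p_lip) auto
        also have "\<dots> \<le> exp (M * (1 / n)) * p y"
          using near \<open>M \<ge> 0\<close> by (intro mult_right_mono p_nonneg iffD2[OF exp_le_cancel_iff] mult_left_mono) auto
        finally have "p (y + u / (real n)\<^sup>2) * exp (- (1 + u / ((real n)\<^sup>2 * y))) \<le> (exp (M * (1 / n)) * p y) * exp (- 1 + 1 / n)"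
          using abs_le_D2[OF near(3)] by (intro mult_mono iffD2[OF exp_le_cancel_iff]) (auto simp: p_nonneg)
        also have "\<dots> = p y * exp (M * (1 / n) + (- 1 + 1 / n))"
          unfolding exp_add by simp
        also have "M * (1 / n) + (- 1 + 1 / n) = - 1 + (M + 1) / n"
          by (simp add: add_divide_distrib)
        finally show ?thesis using True by (simp add: mult_right_mono K_nonneg S_def)
      next
        case False
        have "p (y + u / (real n)\<^sup>2) * exp (- (1 + u / ((real n)\<^sup>2 * y))) \<le> Cb * y powr a"
        proof (cases "y + u / (real n)\<^sup>2 \<ge> 0")
          case True
          have "(y + u / (real n)\<^sup>2) / y = 1 + u / ((real n)\<^sup>2 * y)"
            using elim by (simp add: add_divide_distrib)
          thus ?thesis using Cb(2)[OF True, of y] elim by simp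
        next
          case False
          thus ?thesis using Cb(1) by (simp add: p_neg)
        qed
        thus ?thesis using False by (simp add: mult_right_mono K_nonneg S_def)
      qed
    qed (use elim int_ind K in auto)
    also have "\<dots> = p y * exp (- 1 + (M + 1) / n) * J n + Cb * y powr a * (I - J n)"
      using int_ind[of S] K by (simp add: J_def I_def S_def)
    finally have "A ((real n)\<^sup>2) y \<le> (p y * exp (- 1 + (M + 1) / n) * J n + Cb * y powr a * (I - J n)) / y powr a"
      unfolding A_def by (rule divide_right_mono) auto
    also have "\<dots> = p y / y powr a * (exp (- 1 + (M + 1) / n) * J n) + Cb * (I - J n)"
      using elim by (simp add: add_divide_distrib)
    finally show ?case .
  qed
  have inv_n: "(\<lambda>n. C / real n) \<longlonglongrightarrow> 0" for C
    by (rule lim_const_over_n)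
  show ?thesis
  proof (rule order_tendstoI)
    fix d assume "d < c"
    \<comment> \<open>For fixed \<open>n\<close> the mean \<open>A\<close> is eventually above
      \<open>b - 1 / real n\<close>. This slack, the tail and the factor exp((M+1)/n) all disappear
      as \<open>n\<close> grows, so one sufficiently large \<open>n\<close> is fixed before
      \<open>y\<close> is sent to infinity.\<close>
    have "(\<lambda>n. (b - 1 / real n - Cb * (I - J n)) / (exp (- 1 + (M + 1) / n) * J n)) \<longlonglongrightarrow>
             (b - 0 - Cb * (I - I)) / (exp (- 1 + 0) * I)"
      using \<open>I > 0\<close> by (intro tendsto_intros inv_n J_lim) auto
    also have "(b - 0 - Cb * (I - I)) / (exp (- 1 + 0) * I) = c" using \<open>I > 0\<close> by (simp add: b_def)
    finally have "\<forall>\<^sub>F n in sequentially. d < (b - 1 / real n - Cb * (I - J n)) / (exp (- 1 + (M + 1) / n) * J n)"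
      using \<open>d < c\<close> by (rule order_tendstoD)
    from eventually_happens[OF eventually_conj[OF this eventually_conj[OF J_pos eventually_gt_at_top[of 0]]]]
    obtain n where n: "d < (b - 1 / real n - Cb * (I - J n)) / (exp (- 1 + (M + 1) / n) * J n)" "J n > 0" "n > 0"
      by auto
    have "\<forall>\<^sub>F y in at_top. b - 1 / real n < A ((real n)\<^sup>2) y"
      using n by (intro order_tendstoD(1)[OF A_lim]) auto
    with lower[OF n(3)] show "\<forall>\<^sub>F y in at_top. d < p y / y powr a"
    proof eventually_elim
      case (elim y)
      define E where "E = exp (- 1 + (M + 1) / n) * J n"
      have "E > 0" using n by (simp add: E_def)
      have "b - 1 / real n - Cb * (I - J n) \<le> p y / y powr a * E"
        using elim unfolding E_def by linarith
      hence "(b - 1 / real n - Cb * (I - J n)) / E \<le> p y / y powr a"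
        using \<open>E > 0\<close> by (subst pos_divide_le_eq) auto
      with n(1) show ?case unfolding E_def by linarith
    qed
  next
    fix d assume "c < d"
    have "(\<lambda>n. (b + 1 / real n) / (exp (- 1 - (M + 1) / n) * J n)) \<longlonglongrightarrow> (b + 0) / (exp (- 1 - 0) * I)"
      using \<open>I > 0\<close> by (intro tendsto_intros inv_n J_lim) auto
    also have "(b + 0) / (exp (- 1 - 0) * I) = c" using \<open>I > 0\<close> by (simp add: b_def)
    finally have "\<forall>\<^sub>F n in sequentially. (b + 1 / real n) / (exp (- 1 - (M + 1) / n) * J n) < d"
      using \<open>c < d\<close> by (rule order_tendstoD)
    from eventually_happens[OF eventually_conj[OF this eventually_conj[OF J_pos eventually_gt_at_top[of 0]]]]
    obtain n where n: "(b + 1 / real n) / (exp (- 1 - (M + 1) / n) * J n) < d" "J n > 0" "n > 0"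
      by auto
    have "\<forall>\<^sub>F y in at_top. A ((real n)\<^sup>2) y < b + 1 / real n"
      using n by (intro order_tendstoD(2)[OF A_lim]) auto
    with upper[OF n(3)] show "\<forall>\<^sub>F y in at_top. p y / y powr a < d"
    proof eventually_elim
      case (elim y)
      define E where "E = exp (- 1 - (M + 1) / n) * J n"
      have "E > 0" using n by (simp add: E_def)
      have "p y / y powr a * E \<le> b + 1 / real n"
        using elim unfolding E_def by linarith
      hence "p y / y powr a \<le> (b + 1 / real n) / E"
        using \<open>E > 0\<close> by (subst pos_le_divide_eq) auto
      with n(1) show ?case unfolding E_def by linarith
    qed
  qed
qed

section \<open>From improper integrals to Lebesgue integrals\<close>

text \<open>For a nonnegative integrand, convergence of the partial integrals is absolute
  convergence, by monotone convergence. The integrand is cast to the complex numbers so that the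
  convergence hypothesis applies at real \<open>z\<close>.\<close>

lemma integrable_lborel_if_improper_integral_converges:
  fixes g :: "real \<Rightarrow> real"
  assumes meas: "(\<lambda>t. indicator {0..} t * g t) \<in> borel_measurable borel"
    and nonneg: "\<And>t. t \<ge> 0 \<Longrightarrow> g t \<ge> 0"
    and conv: "improper_integral_converges (\<lambda>t. complex_of_real (g t))"
  shows "integrable lborel (\<lambda>t. indicator {0..} t * g t)"
proof -
  define f where "f = (\<lambda>t. indicator {0..} t * g t)"
  have [measurable]: "f \<in> borel_measurable borel" using meas by (simp add: f_def)
  have f_nonneg: "f t \<ge> 0" for t using nonneg by (auto simp: f_def indicator_def)
  obtain I where I: "((\<lambda>R. integral {0..R} (\<lambda>t. complex_of_real (g t))) \<longlongrightarrow> I) at_top"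
    using conv by (auto simp: improper_integral_converges_def)
  have part: "integrable lborel (\<lambda>t. f t * indicator {..R} t) \<and> (\<integral>t. f t * indicator {..R} t \<partial>lborel) = Re (integral {0..R} (\<lambda>t. complex_of_real (g t)))"
    if "R \<ge> 0" for R
  proof -
    have "(\<lambda>t. complex_of_real (g t)) integrable_on {0..R}"
      using conv that by (auto simp: improper_integral_converges_def)
    hence "((\<lambda>t. complex_of_real (g t)) has_integral (integral {0..R} (\<lambda>t. complex_of_real (g t)))) {0..R}"
      by (rule integrable_integral)
    hence "((\<lambda>t. Re (complex_of_real (g t))) has_integral Re (integral {0..R} (\<lambda>t. complex_of_real (g t)))) {0..R}"
      by (rule has_integral_Re)
    hence "((\<lambda>t. if t \<in> {0..R} then g t else 0) has_integral Re (integral {0..R} (\<lambda>t. complex_of_real (g t)))) UNIV"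
      by (subst has_integral_restrict_UNIV) simp
    also have "(\<lambda>t. if t \<in> {0..R} then g t else 0) = (\<lambda>t. f t * indicator {..R} t)"
      by (auto simp: fun_eq_iff f_def indicator_def)
    finally have hi: "((\<lambda>t. f t * indicator {..R} t) has_integral Re (integral {0..R} (\<lambda>t. complex_of_real (g t)))) UNIV" .
    have nn: "f t * indicator {..R} t \<ge> 0" for t using f_nonneg by simp
    have "Re (integral {0..R} (\<lambda>t. complex_of_real (g t))) \<ge> 0"
      using hi by (rule has_integral_nonneg) (rule nn)
    with nn have "has_bochner_integral lborel (\<lambda>t. f t * indicator {..R} t) (Re (integral {0..R} (\<lambda>t. complex_of_real (g t))))"
      using nn_integral_has_integral_lborel[OF _ _ hi] by (intro has_bochner_integral_nn_integral) auto
    thus ?thesis by (auto simp: has_bochner_integral_iff)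
  qed
  show ?thesis unfolding f_def[symmetric]
  proof (rule integrable_monotone_convergence_at_top)
    show "integrable lborel (\<lambda>t. f t * indicator {..R} t)" for R
    proof (cases "R \<ge> 0")
      case False
      hence "(\<lambda>t. f t * indicator {..R} t) = (\<lambda>t. 0)" by (auto simp: fun_eq_iff f_def indicator_def)
      thus ?thesis by simp
    qed (use part in auto)
    have "((\<lambda>R. Re (integral {0..R} (\<lambda>t. complex_of_real (g t)))) \<longlongrightarrow> Re I) at_top"
      by (intro tendsto_intros I)
    moreover have "\<forall>\<^sub>F R in at_top. (\<integral>t. f t * indicator {..R} t \<partial>lborel) = Re (integral {0..R} (\<lambda>t. complex_of_real (g t)))"
      using eventually_ge_at_top[of 0] by eventually_elim (use part in auto)
    ultimately show "((\<lambda>R. \<integral>t. f t * indicator {..R} t \<partial>lborel) \<longlongrightarrow> Re I) at_top"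
      by (subst tendsto_cong) auto
  qed (use f_nonneg in auto)
qed

lemma improper_integral_eq_lborel:
  fixes f :: "real \<Rightarrow> complex"
  assumes "integrable lborel (\<lambda>t. indicator {0..} t *\<^sub>R f t)"
  shows "improper_integral f = (\<integral>t. indicator {0..} t *\<^sub>R f t \<partial>lborel)"
proof -
  have si: "set_integrable lborel {0..} f" using assms by (simp add: set_integrable_def)
  have "((\<lambda>R. set_lebesgue_integral lborel {0..R} f) \<longlongrightarrow> set_lebesgue_integral lborel {0..} f) at_top"
    by (rule tendsto_set_lebesgue_integral_at_top) (use si in \<open>auto intro: set_integrable_subset\<close>)
  moreover have "set_lebesgue_integral lborel {0..R} f = integral {0..R} f" for R
    by (rule set_borel_integral_eq_integral) (use si in \<open>auto intro: set_integrable_subset\<close>)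
  ultimately have "((\<lambda>R. integral {0..R} f) \<longlongrightarrow> set_lebesgue_integral lborel {0..} f) at_top" by simp
  thus ?thesis
    unfolding improper_integral_def set_lebesgue_integral_def by (rule tendsto_Lim[rotated]) simp
qed

section \<open>Rescaling Fejer means\<close>

text \<open>The kernel \<open>fejer 1\<close> is at most 5, so integrability of the damped function
  survives the affine substitution.\<close>

lemma integrable_fejer_shift:
  fixes F :: "real \<Rightarrow> real"
  assumes "integrable lborel (\<lambda>t. F t * exp (- t / y))" "L > 0" "y > 0" and [measurable]: "F \<in> borel_measurable borel"
  shows "integrable lborel (\<lambda>u. F (y + u / L) * exp (- (1 + u / (L * y))) * fejer 1 u)"
proof (rule Bochner_Integration.integrable_bound)
  show "integrable lborel (\<lambda>u. 5 * (F (y + 1 / L * u) * exp (- (y + 1 / L * u) / y)))"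
    using assms by (intro integrable_mult_right lborel_integrable_real_affine[OF assms(1)]) auto
  have "fejer 1 u \<le> 5" for u
    using fejer_1_bound[of u] inverse_le_1_iff[of "1 + u\<^sup>2"] by (simp add: order_trans)
  moreover have "- (y + 1 / L * u) / y = - (1 + u / (L * y))" for u
    using assms by (simp add: field_simps)
  ultimately show "AE u in lborel. norm (F (y + u / L) * exp (- (1 + u / (L * y))) * fejer 1 u)
     \<le> norm (5 * (F (y + 1 / L * u) * exp (- (y + 1 / L * u) / y)))"
    using fejer_nonneg[of 1]
    by (intro AE_I2) (simp add: abs_mult mult.commute mult_right_mono)
qed auto

text \<open>Substitute \<open>t = y + u / L\<close>. By \<open>fejer_scale\<close> the kernel
  absorbs the Jacobian, and the width parameter moves into the argument of \<open>F\<close>.\<close>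

lemma integral_fejer_shift:
  fixes F :: "real \<Rightarrow> real"
  assumes "L > 0" "y > 0"
  shows "(\<integral>t. F t * exp (- t / y) * fejer L (t - y) \<partial>lborel) =
    (\<integral>u. F (y + u / L) * exp (- (1 + u / (L * y))) * fejer 1 u \<partial>lborel)"
proof -
  have "(\<integral>t. F t * exp (- t / y) * fejer L (t - y) \<partial>lborel) =
     \<bar>1 / L\<bar> *\<^sub>R (\<integral>u. F (y + 1 / L * u) * exp (- (y + 1 / L * u) / y) * fejer L ((y + 1 / L * u) - y) \<partial>lborel)"
    using assms by (intro lborel_integral_real_affine) auto
  also have "\<dots> = (\<integral>u. F (y + 1 / L * u) * exp (- (y + 1 / L * u) / y) * (fejer L ((y + 1 / L * u) - y) / L) \<partial>lborel)"
    using assms by simp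
  also have "(\<lambda>u. F (y + 1 / L * u) * exp (- (y + 1 / L * u) / y) * (fejer L ((y + 1 / L * u) - y) / L)) = 
     (\<lambda>u. F (y + u / L) * exp (- (1 + u / (L * y))) * fejer 1 u)"
  proof
    fix u
    have "- (y + 1 / L * u) / y = - (1 + u / (L * y))"
      using assms by (simp add: field_simps)
    moreover have "fejer L ((y + 1 / L * u) - y) / L = fejer 1 u"
      using assms by (simp add: fejer_scale[of L])
    ultimately show "F (y + 1 / L * u) * exp (- (y + 1 / L * u) / y) * (fejer L ((y + 1 / L * u) - y) / L) = 
      F (y + u / L) * exp (- (1 + u / (L * y))) * fejer 1 u" by simp
  qed
  finally show ?thesis .
qed

text \<open>Split \<open>p = G + E\<close> with E(t) = c t^a. The transform of \<open>G\<close> has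
  a uniform boundary limit, so its Fejer means vanish by \<open>fejer_mean_tendsto_0\<close>; those
  of \<open>E\<close> are computed by \<open>powr_exp_mean_tendsto\<close>. Their sum is the input
  of \<open>tauberian_kernel\<close>.\<close>

theorem ikehara_delange:
  fixes p :: "real \<Rightarrow> real" and l :: "real \<Rightarrow> complex" and a c M \<sigma> :: real
  assumes p_meas [measurable]: "p \<in> borel_measurable borel"
    and p_nonneg: "\<And>t. p t \<ge> 0" and p_neg: "\<And>t. t < 0 \<Longrightarrow> p t = 0"
    and p_lip: "\<And>s t. 0 \<le> s \<Longrightarrow> 0 \<le> t \<Longrightarrow> p s \<le> exp (M * \<bar>s - t\<bar>) * p t"
    and "M \<ge> 0" "a \<ge> 0" "\<sigma> > 0"
    and p_int: "\<And>x. 0 < x \<Longrightarrow> x < \<sigma> \<Longrightarrow> integrable lborel (\<lambda>t. p t * exp (- x * t))"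
    and lim: "\<And>L. L > 0 \<Longrightarrow> uniform_limit {-L..L}
      (\<lambda>x \<tau>. (\<integral>t. of_real (p t * exp (- x * t)) * cis (\<tau> * t) \<partial>lborel) -
          of_real (c * Gamma (a + 1)) / (of_real x - \<i> * of_real \<tau>) powr of_real (a + 1)) l (at_right 0)"
  shows "((\<lambda>y. p y / y powr a) \<longlongrightarrow> c) at_top"
proof -
  define E where "E = (\<lambda>t::real. c * (indicator {0..} t * t powr a))"
  define G where "G = (\<lambda>t. p t - E t)"
  define q where "q = (\<lambda>s. indicator {0..} s * s powr a * exp (- s) :: real)"
  have [measurable]: "E \<in> borel_measurable borel" unfolding E_def by measurable
  have E_int: "integrable lborel (\<lambda>t. E t * exp (- x * t))" if "x > 0" for x
    using has_bochner_integral_laplace_powr_real[of "a + 1" x] that \<open>a \<ge> 0\<close>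
    by (simp add: E_def has_bochner_integral_iff mult.assoc)
  have G_int: "integrable lborel (\<lambda>t. G t * exp (- x * t))" if "0 < x" "x < \<sigma>" for x
    using p_int[OF that] E_int[OF that(1)] by (simp add: G_def left_diff_distrib)
  have G_lap: "(\<integral>t. of_real (G t * exp (- x * t)) * cis (\<tau> * t) \<partial>lborel) =
      (\<integral>t. of_real (p t * exp (- x * t)) * cis (\<tau> * t) \<partial>lborel) -
          of_real (c * Gamma (a + 1)) / (of_real x - \<i> * of_real \<tau>) powr of_real (a + 1)"
    if "0 < x" "x < \<sigma>" for x \<tau>
  proof -
    define s where "s = of_real x - \<i> * complex_of_real \<tau>"
    have "Re s > 0" using that by (simp add: s_def)
    have "exp (- s * of_real t) = of_real (exp (- x * t)) * cis (\<tau> * t)" for t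
      by (simp add: s_def cis_conv_exp flip: exp_add exp_of_real) (simp add: algebra_simps)
    hence E_eq: "of_real c * (of_real (indicator {0..} t * t powr a) * exp (- s * of_real t)) = of_real (E t * exp (- x * t)) * cis (\<tau> * t)" for t
      by (simp add: E_def)
    have "has_bochner_integral lborel (\<lambda>t. of_real c * (of_real (indicator {0..} t * t powr a) * exp (- s * of_real t)))
        (of_real c * (of_real (Gamma (a + 1)) / s powr of_real (a + 1)))"
      using has_bochner_integral_laplace_powr_complex[of "a + 1" s] \<open>Re s > 0\<close> \<open>a \<ge> 0\<close>
      by (intro has_bochner_integral_mult_right) simp
    hence E_lap: "has_bochner_integral lborel (\<lambda>t. of_real (E t * exp (- x * t)) * cis (\<tau> * t))
        (of_real (c * Gamma (a + 1)) / s powr of_real (a + 1))"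
      unfolding E_eq by simp
    have p_lap: "integrable lborel (\<lambda>t. complex_of_real (p t * exp (- x * t)) * cis (\<tau> * t))"
      by (rule Bochner_Integration.integrable_bound[OF p_int[OF that]]) (auto simp: norm_mult)
    show ?thesis
      using E_lap p_lap by (simp add: G_def left_diff_distrib has_bochner_integral_iff s_def)
  qed
  have ev_x: "\<forall>\<^sub>F x in at_right 0. 0 < x \<and> x < \<sigma>"
    unfolding eventually_at_right_field using \<open>\<sigma> > 0\<close> by auto
  define N where "N = (\<lambda>L y. \<integral>t. G t * exp (- t / y) * fejer L (t - y) \<partial>lborel)"
  have N_lim: "(N L \<longlongrightarrow> 0) at_top" if "L > 0" for L
    unfolding N_def
  proof (rule fejer_mean_tendsto_0[OF that \<open>\<sigma> > 0\<close> G_int])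
    show "uniform_limit {-L..L} (\<lambda>x \<tau>. \<integral>t. of_real (G t * exp (- x * t)) * cis (\<tau> * t) \<partial>lborel) l (at_right 0)"
      using lim[OF that] by (rule uniform_limit_cong[THEN iffD1, rotated -1])
         (use ev_x in eventually_elim, use G_lap in auto)
  qed
  \<comment> \<open>The second condition puts the coupled abscissa \<open>1 / y\<close> inside the
    range where the transform of \<open>p\<close> converges.\<close>
  have ev_y: "\<forall>\<^sub>F y in at_top. y \<ge> 1 \<and> 1 / y < \<sigma>"
    using eventually_conj[OF eventually_ge_at_top[of 1] eventually_gt_at_top[of "1 / \<sigma>"]]
    by eventually_elim (use \<open>\<sigma> > 0\<close> in \<open>auto simp: field_simps\<close>)
  have p_shift: "integrable lborel (\<lambda>u. p (y + u / L) * exp (- (1 + u / (L * y))) * fejer 1 u)"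
    if "L > 0" "y \<ge> 1" "1 / y < \<sigma>" for L y
    using p_int[of "1 / y"] that by (intro integrable_fejer_shift) auto
  show ?thesis
  proof (rule tauberian_kernel[where K = "fejer 1" and M = M])
    fix L :: real assume "L > 0"
    show "\<forall>\<^sub>F y in at_top. integrable lborel (\<lambda>u. p (y + u / L) * exp (- (1 + u / (L * y))) * fejer 1 u)"
      using ev_y by eventually_elim (use p_shift \<open>L > 0\<close> in auto)
    \<comment> \<open>Here \<open>a \<ge> 0\<close> makes the divisor at least 1 for
      \<open>y \<ge> 1\<close>.\<close>
    have "((\<lambda>y. N L y / y powr a) \<longlongrightarrow> 0) at_top"
    proof (rule Lim_null_comparison)
      show "((\<lambda>y. \<bar>N L y\<bar>) \<longlongrightarrow> 0) at_top" using N_lim[OF \<open>L > 0\<close>] by (rule tendsto_rabs_zero)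
      show "\<forall>\<^sub>F y in at_top. norm (N L y / y powr a) \<le> \<bar>N L y\<bar>"
        using eventually_ge_at_top[of 1]
      proof eventually_elim
        case (elim y)
        hence "y powr a \<ge> 1" using \<open>a \<ge> 0\<close> by (simp add: ge_one_powr_ge_zero)
        hence "\<bar>N L y\<bar> / y powr a \<le> \<bar>N L y\<bar> / 1" by (intro divide_left_mono) auto
        thus ?case by simp
      qed
    qed
    moreover have "((\<lambda>y. c * (\<integral>u. q (1 + u / (L * y)) * fejer 1 u \<partial>lborel)) \<longlongrightarrow> c * (exp (- 1) * integral\<^sup>L lborel (fejer 1))) at_top"
      unfolding q_def by (intro tendsto_intros powr_exp_mean_tendsto \<open>a \<ge> 0\<close> \<open>L > 0\<close> integrable_fejer_1)
    ultimately have "((\<lambda>y. N L y / y powr a + c * (\<integral>u. q (1 + u / (L * y)) * fejer 1 u \<partial>lborel)) \<longlongrightarrow>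
        0 + c * (exp (- 1) * integral\<^sup>L lborel (fejer 1))) at_top"
      by (rule tendsto_add)
    moreover have "\<forall>\<^sub>F y in at_top. N L y / y powr a + c * (\<integral>u. q (1 + u / (L * y)) * fejer 1 u \<partial>lborel) =
        (\<integral>u. p (y + u / L) * exp (- (1 + u / (L * y))) * fejer 1 u \<partial>lborel) / y powr a"
      using ev_y
    proof eventually_elim
      case (elim y)
      have E_shift: "integrable lborel (\<lambda>u. E (y + u / L) * exp (- (1 + u / (L * y))) * fejer 1 u)"
        using E_int[of "1 / y"] elim \<open>L > 0\<close> by (intro integrable_fejer_shift) auto
      have E_eq: "E (y + u / L) * exp (- (1 + u / (L * y))) * fejer 1 u = c * y powr a * (q (1 + u / (L * y)) * fejer 1 u)" for u
      proof -
        have "y + u / L = y * (1 + u / (L * y))" using elim \<open>L > 0\<close> by (simp add: field_simps)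
        thus ?thesis
          using elim by (simp only: E_def q_def) (auto simp: indicator_def powr_mult zero_le_mult_iff)
      qed
      have "N L y = (\<integral>u. p (y + u / L) * exp (- (1 + u / (L * y))) * fejer 1 u -
                         E (y + u / L) * exp (- (1 + u / (L * y))) * fejer 1 u \<partial>lborel)"
        unfolding N_def using elim \<open>L > 0\<close>
        by (subst integral_fejer_shift) (auto simp: G_def left_diff_distrib)
      also have "\<dots> = (\<integral>u. p (y + u / L) * exp (- (1 + u / (L * y))) * fejer 1 u \<partial>lborel) -
                      c * y powr a * (\<integral>u. q (1 + u / (L * y)) * fejer 1 u \<partial>lborel)"
        using p_shift[of L y] E_shift elim \<open>L > 0\<close> unfolding E_eq
        by (subst Bochner_Integration.integral_diff) auto
      finally show ?case using elim by (simp add: field_simps)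
    qed
    ultimately show "((\<lambda>y. (\<integral>u. p (y + u / L) * exp (- (1 + u / (L * y))) * fejer 1 u \<partial>lborel) / y powr a) \<longlongrightarrow>
        c * exp (- 1) * integral\<^sup>L lborel (fejer 1)) at_top"
      by (simp add: tendsto_cong mult.assoc)
  qed (use assms fejer_nonneg integrable_fejer_1 integral_fejer_1_pos in auto)
qed

section \<open>Reduction to the transform of \<open>p\<close> on the right half-plane\<close>

theorem proposition2p4:
  fixes \<phi> :: "real \<Rightarrow> real" and \<mu> \<nu> j D :: real
    and h :: "real \<Rightarrow> complex" and H :: "complex \<Rightarrow> complex"
  assumes phi_nonneg: "\<And>t. t \<ge> 0 \<Longrightarrow> \<phi> t \<ge> 0"
    and phi_antimono: "antimono_on {0..} \<phi>"
    and "\<mu> > 0" and "\<nu> > 0"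
    and exp_phi_mono: "mono_on {0..} (\<lambda>t. exp (\<nu> * t) * \<phi> t)"
    and rs_conv: "\<And>z :: complex. 0 < Re z \<Longrightarrow> Re z < \<mu> \<Longrightarrow>
      improper_rs_integral_converges (\<lambda>t. exp (z * of_real t)) \<phi>"
    and "j \<ge> 1" and "D > 0"
    and conv: "\<And>z :: complex. 0 < Re z \<Longrightarrow> Re z < \<mu> \<Longrightarrow>
      improper_integral_converges (\<lambda>t. exp (z * of_real t) * of_real (\<phi> t))"
    and H_eq: "\<And>z :: complex. 0 < Re z \<Longrightarrow> Re z < \<mu> \<Longrightarrow>
      H z = improper_integral (\<lambda>t. exp (z * of_real t) * of_real (\<phi> t))
            - of_real D / (of_real \<mu> - z) powr (of_real j)"
    and H_lim: "\<And>K :: real set. compact K \<Longrightarrow>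
      uniform_limit K (\<lambda>x \<tau>. H (Complex x \<tau>)) h (at_left \<mu>)"
  shows "\<phi> \<sim>[at_top] (\<lambda>t. D / Gamma j * t powr (j - 1) * exp (- \<mu> * t))"
proof -
  define p where "p = (\<lambda>t. indicator {0..} t * (exp (\<mu> * t) * \<phi> t))"
  define c where "c = D / Gamma j"
  have Gamma_pos: "Gamma j > 0" using \<open>j \<ge> 1\<close> by (intro Gamma_real_pos) auto
  hence "c > 0" using \<open>D > 0\<close> by (simp add: c_def)
  have p_nonneg: "p t \<ge> 0" for t using phi_nonneg[of t] by (auto simp: p_def indicator_def)
  \<comment> \<open>Nothing is assumed about \<open>\<phi>\<close> at negative arguments. Extending
    it by the constant \<open>\<phi> 0\<close> gives a function monotone on the whole line, hence
    Borel.\<close>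
  have "mono (\<lambda>t. - \<phi> (max 0 t))"
    using phi_antimono by (auto intro!: monoI simp: monotone_on_def)
  hence "(\<lambda>t. - \<phi> (max 0 t)) \<in> borel_measurable borel" by (rule borel_measurable_mono)
  hence "(\<lambda>t. - (- \<phi> (max 0 t))) \<in> borel_measurable borel" by (rule borel_measurable_uminus)
  hence [measurable]: "(\<lambda>t. \<phi> (max 0 t)) \<in> borel_measurable borel" by simp
  have "(\<lambda>t. indicator {0..} t * (exp (\<mu> * t) * \<phi> (max 0 t))) \<in> borel_measurable borel"
    by measurable
  also have "(\<lambda>t. indicator {0..} t * (exp (\<mu> * t) * \<phi> (max 0 t))) = p"
    by (auto simp: fun_eq_iff p_def indicator_def)
  finally have p_meas [measurable]: "p \<in> borel_measurable borel" .
  have p_exp: "p t * exp (- x * t) = indicator {0..} t * (exp ((\<mu> - x) * t) * \<phi> t)" for x t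
  proof -
    have "exp (\<mu> * t) * exp (- x * t) = exp ((\<mu> - x) * t)"
      by (simp add: algebra_simps flip: exp_add)
    thus ?thesis by (simp add: p_def mult_ac)
  qed
  have p_int: "integrable lborel (\<lambda>t. p t * exp (- x * t))" if "0 < x" "x < \<mu>" for x
    unfolding p_exp
  proof (rule integrable_lborel_if_improper_integral_converges)
    show "(\<lambda>t. indicator {0..} t * (exp ((\<mu> - x) * t) * \<phi> t)) \<in> borel_measurable borel"
      unfolding p_exp[symmetric] by measurable
    have "improper_integral_converges (\<lambda>t. exp (complex_of_real (\<mu> - x) * of_real t) * of_real (\<phi> t))"
      using that by (intro conv) auto
    also have "(\<lambda>t. exp (complex_of_real (\<mu> - x) * of_real t) * of_real (\<phi> t)) = (\<lambda>t. complex_of_real (exp ((\<mu> - x) * t) * \<phi> t))"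
      by (simp add: fun_eq_iff flip: exp_of_real)
    finally show "improper_integral_converges (\<lambda>t. complex_of_real (exp ((\<mu> - x) * t) * \<phi> t))" .
  qed (simp add: phi_nonneg)
  \<comment> \<open>To the right \<open>\<phi>\<close> decreases, so \<open>p\<close> grows at rate
    at most \<open>\<mu>\<close>. To the left the growth of exp(\<nu> t) \<phi>(t) gives the rate
    \<open>\<nu> - \<mu>\<close>. Both are below \<open>\<mu> + \<nu>\<close>.\<close>
  have p_lip: "p s \<le> exp ((\<mu> + \<nu>) * \<bar>s - t\<bar>) * p t" if "0 \<le> s" "0 \<le> t" for s t
  proof (cases "t \<le> s")
    case True
    have "\<phi> s \<le> \<phi> t" using phi_antimono that True by (auto simp: monotone_on_def)
    hence "p s \<le> exp (\<mu> * s) * \<phi> t" using that by (simp add: p_def)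
    also have "\<dots> = exp (\<mu> * (s - t)) * p t"
      using that by (simp add: p_def algebra_simps flip: exp_add)
    also have "\<dots> \<le> exp ((\<mu> + \<nu>) * \<bar>s - t\<bar>) * p t"
      using True \<open>\<nu> > 0\<close>
      by (intro mult_right_mono p_nonneg iffD2[OF exp_le_cancel_iff] mult_mono) (use \<open>\<mu> > 0\<close> in auto)
    finally show ?thesis .
  next
    case False
    have "exp (\<nu> * s) * \<phi> s \<le> exp (\<nu> * t) * \<phi> t"
      using exp_phi_mono that False by (auto simp: monotone_on_def)
    hence "exp ((\<mu> - \<nu>) * s) * (exp (\<nu> * s) * \<phi> s) \<le> exp ((\<mu> - \<nu>) * s) * (exp (\<nu> * t) * \<phi> t)"
      by (intro mult_left_mono) auto
    also have "exp ((\<mu> - \<nu>) * s) * (exp (\<nu> * s) * \<phi> s) = p s"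
      using that by (simp add: p_def algebra_simps flip: exp_add)
    also have "exp ((\<mu> - \<nu>) * s) * (exp (\<nu> * t) * \<phi> t) = exp ((\<nu> - \<mu>) * (t - s)) * p t"
      using that by (simp add: p_def algebra_simps flip: exp_add)
    also have "\<dots> \<le> exp ((\<mu> + \<nu>) * \<bar>s - t\<bar>) * p t"
    proof -
      have "(\<nu> - \<mu>) * (t - s) \<le> (\<mu> + \<nu>) * (t - s)"
        using False \<open>\<mu> > 0\<close> by (intro mult_right_mono) auto
      thus ?thesis using False by (intro mult_right_mono p_nonneg) auto
    qed
    finally show ?thesis .
  qed
  \<comment> \<open>Put z = \<mu> - x + i\<tau>, so that \<mu> - z = x - i\<tau> and
    \<open>x\<close> tends to 0 from the right exactly when Re z tends to \<open>\<mu>\<close> from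
    the left.\<close>
  have p_lap: "(\<integral>t. of_real (p t * exp (- x * t)) * cis (\<tau> * t) \<partial>lborel) -
      of_real D / (of_real x - \<i> * of_real \<tau>) powr of_real j = H (Complex (\<mu> - x) \<tau>)"
    if "0 < x" "x < \<mu>" for x \<tau>
  proof -
    define z where "z = Complex (\<mu> - x) \<tau>"
    have eq: "of_real (p t * exp (- x * t)) * cis (\<tau> * t) = indicator {0..} t *\<^sub>R (exp (z * of_real t) * of_real (\<phi> t))" for t
    proof -
      have "exp (z * of_real t) = of_real (exp ((\<mu> - x) * t)) * cis (\<tau> * t)"
        by (simp add: z_def exp_eq_polar)
      thus ?thesis unfolding p_exp by (simp add: scaleR_conv_of_real)
    qed
    have "integrable lborel (\<lambda>t. complex_of_real (p t * exp (- x * t)) * cis (\<tau> * t))"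
      by (rule Bochner_Integration.integrable_bound[OF p_int[OF that]]) (auto simp: norm_mult)
    hence "improper_integral (\<lambda>t. exp (z * of_real t) * of_real (\<phi> t)) =
        (\<integral>t. of_real (p t * exp (- x * t)) * cis (\<tau> * t) \<partial>lborel)"
      unfolding eq by (rule improper_integral_eq_lborel)
    moreover have "of_real \<mu> - z = of_real x - \<i> * of_real \<tau>"
      by (simp add: z_def complex_eq_iff)
    ultimately show ?thesis using that by (simp add: H_eq z_def)
  qed
  have "((\<lambda>t. p t / t powr (j - 1)) \<longlongrightarrow> c) at_top"
  proof (rule ikehara_delange[where M = "\<mu> + \<nu>" and \<sigma> = \<mu> and l = h])
    fix L :: real assume "L > 0"
    have flt: "filterlim (\<lambda>x. \<mu> - x) (at_left \<mu>) (at_right 0)"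
      unfolding filterlim_at
    proof
      show "\<forall>\<^sub>F x in at_right 0. \<mu> - x \<in> {..<\<mu>} \<and> \<mu> - x \<noteq> \<mu>"
        by (auto simp: eventually_at_filter)
      have "((\<lambda>x. \<mu> - x) \<longlongrightarrow> \<mu> - 0) (at_right 0)" by (intro tendsto_intros)
      thus "((\<lambda>x. \<mu> - x) \<longlongrightarrow> \<mu>) (at_right 0)" by simp
    qed
    have "uniform_limit {-L..L} (\<lambda>x \<tau>. H (Complex x \<tau>)) h (at_left \<mu>)"
      by (rule H_lim) auto
    hence "uniform_limit {-L..L} (\<lambda>x \<tau>. H (Complex (\<mu> - x) \<tau>)) h (at_right 0)"
      unfolding uniform_limit_iff using eventually_compose_filterlim[OF _ flt] by blast
    moreover have "\<forall>\<^sub>F x in at_right 0. 0 < x \<and> x < \<mu>"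
      unfolding eventually_at_right_field using \<open>\<mu> > 0\<close> by auto
    hence "\<forall>\<^sub>F x in at_right 0. \<forall>\<tau>\<in>{-L..L}. H (Complex (\<mu> - x) \<tau>) =
        (\<integral>t. of_real (p t * exp (- x * t)) * cis (\<tau> * t) \<partial>lborel) -
          of_real (c * Gamma (j - 1 + 1)) / (of_real x - \<i> * of_real \<tau>) powr of_real (j - 1 + 1)"
      by eventually_elim (use p_lap Gamma_pos in \<open>simp add: c_def\<close>)
    ultimately show "uniform_limit {-L..L}
      (\<lambda>x \<tau>. (\<integral>t. of_real (p t * exp (- x * t)) * cis (\<tau> * t) \<partial>lborel) -
          of_real (c * Gamma (j - 1 + 1)) / (of_real x - \<i> * of_real \<tau>) powr of_real (j - 1 + 1)) h (at_right 0)"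
      by (subst uniform_limit_cong[symmetric]) auto
  qed (use assms p_meas p_nonneg p_lip p_int in \<open>auto simp: p_def\<close>)
  hence "((\<lambda>t. p t / t powr (j - 1) / c) \<longlongrightarrow> c / c) at_top"
    using \<open>c > 0\<close> by (intro tendsto_intros) auto
  hence "((\<lambda>t. p t / t powr (j - 1) / c) \<longlongrightarrow> 1) at_top" using \<open>c > 0\<close> by simp
  moreover have "\<forall>\<^sub>F t in at_top. p t / t powr (j - 1) / c = \<phi> t / (D / Gamma j * t powr (j - 1) * exp (- \<mu> * t))"
    using eventually_gt_at_top[of 0]
    by eventually_elim (simp add: p_def c_def exp_minus field_simps)
  ultimately show ?thesis
    by (intro asymp_equivI') (simp add: tendsto_cong)
qed

end
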